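(* Let $n\geq 3$, let $\alpha=(\alpha_1,\ldots,\alpha_n)$ be a generic $n$-tuple of positive real numbers, and let $X=X(\alpha)$ be the associated hyperpolygon space. Let $S\subseteq\{1,\ldots,n\}$ be a short subset with $|S|\geq 2$. Then the core component $U_S\subseteq X$ is smooth of complex dimension $n-3$, and $$U_S=\big\{[p,q]\in X \;\big|\; S\text{ is straight in }(p,q)\text{, and }p_j=0\text{ for all }j\in S^c\big\}.$$
   Context: Generic: there is no subset $S\subseteq\{1,\ldots,n\}$ with $\sum_{i\in S}\alpha_i=\sum_{j\in S^c}\alpha_j$, where $S^c=\{1,\ldots,n\}\setminus S$. A subset $S$ is short if $\sum_{i\in S}\alpha_i<\sum_{j\in S^c}\alpha_j$, and long otherwise. Groups and action: $G=\big(SL(2,\mathbb{C})\times(\mathbb{C}^* )^n\big)/\mathbb{Z}_2$, with $\mathbb{Z}_2$ acting by multiplying every factor by $-1$. Points of $T^*\mathbb{C}^{2n}$ are written $(p,q)$, where $q=(q_1,\ldots,q_n)$ is an $n$-tuple of column vectors in $\mathbb{C}^2$ and $p=(p_1,\ldots,p_n)$ is an $n$-tuple of row vectors in $\mathbb{C}^2$. $G$ acts on the right by $(p,q)[A;e_1,\ldots,e_n]=\big((e_1^{-1}p_1A,\ldots,e_n^{-1}p_nA),(A^{-1}q_1e_1,\ldots,A^{-1}q_ne_n)\big)$. The complex moment map $\mu_{\mathbb{C}}$ satisfies: $\mu_{\mathbb{C}}(p,q)=0$ iff $\sum_i(q_ip_i)_0=0$ (traceless part) and $p_iq_i=0$ for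 all $i$. Straight: $S$ is straight in $(p,q)$ if $q_i$ is proportional to $q_j$ for all $i,j\in S$. Stability: $(p,q)$ is $\alpha$-stable iff (1) $q_i\neq0$ for all $i$, and (2) whenever a subset $S$ is straight in $(p,q)$ and $p_j=0$ for all $j\in S^c$, then $S$ is short. The hyperpolygon space is the complex manifold $X=X(\alpha)=\mu_{\mathbb{C}}^{-1}(0)^{\alpha\text{-st}}/G$ of complex dimension $2(n-3)$; $[p,q]$ denotes the $G$-orbit of $(p,q)\in\mu_{\mathbb{C}}^{-1}(0)^{\alpha\text{-st}}$. $\mathbb{C}^*$ acts on $X$ by $\lambda\cdot[p,q]=[\lambda p,q]$. For a short subset $S$ with $|S|\geq2$, let $X_S=\{[p,q]\in X\mid S\text{ and }S^c\text{ are each straight, and }p_j=0\text{ for all }j\in S^c\}$ (a component of $X^{\mathbb{C}^*}$), and let $U_S$ be the closure in $X$ of $\{[p,q]\in X\mid \lim_{\lambda\to\infty}\lambda\cdot[p,q]\in X_S\}$. *)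

theory Defs
  imports "HOL-Analysis.Analysis"
begin

text \<open>
  The index set $\{1,\dots,n\}$ is a finite type \<open>'n\<close>, so that $n$ is \<open>CARD('n)\<close> and $S^c$
  is \<open>- S\<close>. A point $(p,q)$ of $T^*\mathbb{C}^{2n}$ is a pair of \<open>'n\<close>-tuples of vectors in
  $\mathbb{C}^2$; the entries of $p$ are used as row vectors (acted on by \<open>v*\<close>), those of $q$
  as column vectors (acted on by \<open>*v\<close>).
\<close>

type_synonym 'n pt = "((complex ^ 2) ^ 'n) \<times> ((complex ^ 2) ^ 'n)"

definition generic :: "('n::finite \<Rightarrow> real) \<Rightarrow> bool" where
  "generic \<alpha> \<longleftrightarrow> (\<nexists>S. sum \<alpha> S = sum \<alpha> (- S))"

definition short :: "('n::finite \<Rightarrow> real) \<Rightarrow> 'n set \<Rightarrow> bool" where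
  "short \<alpha> S \<longleftrightarrow> sum \<alpha> S < sum \<alpha> (- S)"


section \<open>The group action\<close>

text \<open>
  Elements of $G = (SL(2,\mathbb{C}) \times (\mathbb{C}^*)^n)/\mathbb{Z}_2$ are given by
  representatives \<open>(A, e)\<close>. By \<open>act_Z2\<close> below the action does not depend on the
  representative, so the $G$-orbits are the orbits under all representatives.
\<close>

definition G_reps :: "(((complex ^ 2) ^ 2) \<times> ('n::finite \<Rightarrow> complex)) set" where
  "G_reps = {(A, e). det A = 1 \<and> (\<forall>i. e i \<noteq> 0)}"

definition act :: "'n::finite pt \<Rightarrow> ((complex ^ 2) ^ 2) \<times> ('n \<Rightarrow> complex) \<Rightarrow> 'n pt" where
  "act = (\<lambda>(p, q) (A, e).
     (\<chi> i. inverse (e i) *s (p $ i v* A), \<chi> i. matrix_inv A *v (e i *s q $ i)))"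

definition orbit :: "'n::finite pt \<Rightarrow> 'n pt set" where
  "orbit x = act x ` G_reps"


section \<open>The hyperpolygon space as a topological space\<close>

definition outer :: "complex ^ 2 \<Rightarrow> complex ^ 2 \<Rightarrow> (complex ^ 2) ^ 2" where
  "outer v w = (\<chi> a b. v $ a * w $ b)"

definition tracefree :: "(complex ^ 2) ^ 2 \<Rightarrow> (complex ^ 2) ^ 2" where
  "tracefree B = B - mat (trace B / 2)"

definition row_col :: "complex ^ 2 \<Rightarrow> complex ^ 2 \<Rightarrow> complex" where
  "row_col w v = (\<Sum>a\<in>UNIV. w $ a * v $ a)"

text \<open>
  Only the zero set of the moment map is used, so the identification of the dual Lie algebra
  with $\mathfrak{sl}_2 \times \mathbb{C}^n$ (that is, the scaling of the components) is immaterial.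
\<close>

definition moment_map :: "'n::finite pt \<Rightarrow> ((complex ^ 2) ^ 2) \<times> (complex ^ 'n)" where
  "moment_map = (\<lambda>(p, q).
     (\<Sum>i\<in>UNIV. tracefree (outer (q $ i) (p $ i)), \<chi> i. row_col (p $ i) (q $ i)))"

definition straight :: "(complex ^ 2) ^ 'n::finite \<Rightarrow> 'n set \<Rightarrow> bool" where
  "straight q S \<longleftrightarrow> (\<forall>i\<in>S. \<forall>j\<in>S. \<exists>c. q $ i = c *s q $ j)"

definition stable :: "('n::finite \<Rightarrow> real) \<Rightarrow> 'n pt \<Rightarrow> bool" where
  "stable \<alpha> = (\<lambda>(p, q). (\<forall>i. q $ i \<noteq> 0) \<and>
     (\<forall>S. straight q S \<and> (\<forall>j\<in>- S. p $ j = 0) \<longrightarrow> short \<alpha> S))"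

definition level_set :: "('n::finite \<Rightarrow> real) \<Rightarrow> 'n pt set" where
  "level_set \<alpha> = {x. moment_map x = 0 \<and> stable \<alpha> x}"

definition hyperpolygon_space :: "('n::finite \<Rightarrow> real) \<Rightarrow> 'n pt set set" where
  "hyperpolygon_space \<alpha> = orbit ` level_set \<alpha>"

text \<open>The quotient topology of the subspace topology on the level set.\<close>

definition hyperpolygon_top :: "('n::finite \<Rightarrow> real) \<Rightarrow> 'n pt set topology" where
  "hyperpolygon_top \<alpha> = topology (\<lambda>W. W \<subseteq> hyperpolygon_space \<alpha> \<and>
     openin (top_of_set (level_set \<alpha>)) {x \<in> level_set \<alpha>. orbit x \<in> W})"


section \<open>The complex structure\<close>

text \<open>
  Complex differentiability of a function of several complex variables on a subset \<open>V\<close> of a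
  complex linear subspace \<open>E\<close>; \<open>sc\<close> is the scalar multiplication of the ambient complex
  vector space, and \<open>V\<close> is meant to be open in \<open>E\<close>.
\<close>

definition holomorphic_in ::
  "(complex \<Rightarrow> 'v \<Rightarrow> 'v) \<Rightarrow> 'v::real_normed_vector set \<Rightarrow> 'v set \<Rightarrow> ('v \<Rightarrow> complex) \<Rightarrow> bool"
where
  "holomorphic_in sc E V f \<longleftrightarrow> (\<forall>x\<in>V. \<exists>D. (f has_derivative D) (at x within E) \<and>
     (\<forall>c. \<forall>u\<in>E. D (sc c u) = c * D u))"

definition pt_scale :: "complex \<Rightarrow> 'n::finite pt \<Rightarrow> 'n pt" where
  "pt_scale c = (\<lambda>(p, q). (\<chi> i. c *s p $ i, \<chi> i. c *s q $ i))"

text \<open>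
  Holomorphic functions on an open subset of the complex submanifold \<open>level_set \<alpha>\<close> of
  $T^*\mathbb{C}^{2n}$ are the functions that extend locally to holomorphic functions on open
  subsets of $T^*\mathbb{C}^{2n}$.
\<close>

definition level_holomorphic :: "'n::finite pt set \<Rightarrow> ('n pt \<Rightarrow> complex) \<Rightarrow> bool" where
  "level_holomorphic A f \<longleftrightarrow> (\<forall>x\<in>A. \<exists>N F. open N \<and> x \<in> N \<and>
     holomorphic_in pt_scale UNIV N F \<and> (\<forall>y\<in>N \<inter> A. F y = f y))"

text \<open>
  The complex structure of the quotient is given by its sheaf of holomorphic functions: a
  function on an open \<open>W\<close> is holomorphic iff its pull-back to the level set is.
\<close>

definition hyperpolygon_holomorphic ::
  "('n::finite \<Rightarrow> real) \<Rightarrow> 'n pt set set \<Rightarrow> ('n pt set \<Rightarrow> complex) \<Rightarrow> bool"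
where
  "hyperpolygon_holomorphic \<alpha> W f \<longleftrightarrow> openin (hyperpolygon_top \<alpha>) W \<and>
     level_holomorphic {x \<in> level_set \<alpha>. orbit x \<in> W} (f \<circ> orbit)"

text \<open>
  A chart is a homeomorphism of an open \<open>W\<close> onto an open subset of a complex vector space
  \<open>E\<close> that identifies the holomorphic functions on both sides. The dimension $2(n-3)$ of the
  model is not available as a type (it may be zero), so the model \<open>E\<close> is a complex linear
  subspace of that dimension in $\mathbb{C}^{2n}$.
\<close>

definition holomorphic_chart :: "('n::finite \<Rightarrow> real) \<Rightarrow> 'n pt set set \<Rightarrow>
    (complex ^ ('n + 'n)) set \<Rightarrow> ('n pt set \<Rightarrow> complex ^ ('n + 'n)) \<Rightarrow> bool"
where
  "holomorphic_chart \<alpha> W E \<phi> \<longleftrightarrow>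
     openin (hyperpolygon_top \<alpha>) W \<and>
     vec.subspace E \<and> vec.dim E = 2 * (CARD('n) - 3) \<and>
     openin (top_of_set E) (\<phi> ` W) \<and>
     homeomorphic_map (subtopology (hyperpolygon_top \<alpha>) W) (top_of_set (\<phi> ` W)) \<phi> \<and>
     (\<forall>V g. openin (top_of_set E) V \<and> V \<subseteq> \<phi> ` W \<longrightarrow>
        (holomorphic_in (*s) E V g \<longleftrightarrow>
         hyperpolygon_holomorphic \<alpha> {x \<in> W. \<phi> x \<in> V} (g \<circ> \<phi>)))"

text \<open>
  \<open>U\<close> is smooth of complex dimension \<open>d\<close>: a nonempty subset of $X$ that is, around each of
  its points, cut out by a \<open>d\<close>-dimensional linear subspace in a chart of $X$.
\<close>

definition smooth_of_dim :: "('n::finite \<Rightarrow> real) \<Rightarrow> nat \<Rightarrow> 'n pt set set \<Rightarrow> bool" where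
  "smooth_of_dim \<alpha> d U \<longleftrightarrow> U \<noteq> {} \<and> U \<subseteq> hyperpolygon_space \<alpha> \<and>
     (\<forall>x\<in>U. \<exists>W E \<phi> F. x \<in> W \<and> holomorphic_chart \<alpha> W E \<phi> \<and>
        F \<subseteq> E \<and> vec.subspace F \<and> vec.dim F = d \<and> \<phi> ` (W \<inter> U) = \<phi> ` W \<inter> F)"


section \<open>The action of $\mathbb{C}^*$ and the core components\<close>

definition p_scale :: "complex \<Rightarrow> 'n::finite pt \<Rightarrow> 'n pt" where
  "p_scale c = (\<lambda>(p, q). (\<chi> i. c *s p $ i, q))"

text \<open>The orbit of $(\lambda p, q)$ is the image of the orbit of $(p,q)$; see \<open>cstar_orbit\<close> below.\<close>

definition cstar :: "complex \<Rightarrow> 'n::finite pt set \<Rightarrow> 'n pt set" where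
  "cstar c Y = p_scale c ` Y"

definition fixed_component :: "('n::finite \<Rightarrow> real) \<Rightarrow> 'n set \<Rightarrow> 'n pt set set" where
  "fixed_component \<alpha> S = {orbit (p, q) | p q. (p, q) \<in> level_set \<alpha> \<and>
     straight q S \<and> straight q (- S) \<and> (\<forall>j\<in>- S. p $ j = 0)}"

definition core_component :: "('n::finite \<Rightarrow> real) \<Rightarrow> 'n set \<Rightarrow> 'n pt set set" where
  "core_component \<alpha> S = hyperpolygon_top \<alpha> closure_of
     {x \<in> hyperpolygon_space \<alpha>. \<exists>y \<in> fixed_component \<alpha> S.
        limitin (hyperpolygon_top \<alpha>) (\<lambda>c. cstar c x) y at_infinity}"


section \<open>Well-definedness\<close>

lemma openin_hyperpolygon_top:
  "openin (hyperpolygon_top \<alpha>) W \<longleftrightarrow> W \<subseteq> hyperpolygon_space \<alpha> \<and>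
     openin (top_of_set (level_set \<alpha>)) {x \<in> level_set \<alpha>. orbit x \<in> W}"
proof -
  let ?P = "\<lambda>W. {x \<in> level_set \<alpha>. orbit x \<in> W}"
  have "istopology (\<lambda>W. W \<subseteq> hyperpolygon_space \<alpha> \<and> openin (top_of_set (level_set \<alpha>)) (?P W))"
    unfolding istopology_def
  proof (intro conjI allI impI; (elim conjE)?)
    fix V W assume "V \<subseteq> hyperpolygon_space \<alpha>"
    then show "V \<inter> W \<subseteq> hyperpolygon_space \<alpha>" by blast
  next
    fix V W
    assume V: "openin (top_of_set (level_set \<alpha>)) (?P V)"
      and W: "openin (top_of_set (level_set \<alpha>)) (?P W)"
    have "?P (V \<inter> W) = ?P V \<inter> ?P W" by blast
    with openin_Int[OF V W] show "openin (top_of_set (level_set \<alpha>)) (?P (V \<inter> W))"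
      by (simp only:)
  next
    fix K assume K: "\<forall>W\<in>K. W \<subseteq> hyperpolygon_space \<alpha> \<and>
      openin (top_of_set (level_set \<alpha>)) (?P W)"
    then show "\<Union> K \<subseteq> hyperpolygon_space \<alpha>" by blast
    have "?P (\<Union> K) = (\<Union>W\<in>K. ?P W)" by blast
    moreover have "openin (top_of_set (level_set \<alpha>)) (\<Union>W\<in>K. ?P W)"
      using K by (intro openin_Union) blast
    ultimately show "openin (top_of_set (level_set \<alpha>)) (?P (\<Union> K))" by (simp only:)
  qed
  then show ?thesis
    unfolding hyperpolygon_top_def by (subst topology_inverse') simp_all
qed

lemma topspace_hyperpolygon_top: "topspace (hyperpolygon_top \<alpha>) = hyperpolygon_space \<alpha>"
proof
  show "topspace (hyperpolygon_top \<alpha>) \<subseteq> hyperpolygon_space \<alpha>"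
    by (metis openin_hyperpolygon_top openin_topspace)
  have "{x \<in> level_set \<alpha>. orbit x \<in> hyperpolygon_space \<alpha>} = level_set \<alpha>"
    by (auto simp: hyperpolygon_space_def)
  then have "openin (hyperpolygon_top \<alpha>) (hyperpolygon_space \<alpha>)"
    by (simp add: openin_hyperpolygon_top)
  then show "hyperpolygon_space \<alpha> \<subseteq> topspace (hyperpolygon_top \<alpha>)"
    by (rule openin_subset)
qed

lemma cstar_orbit: "cstar c (orbit x) = orbit (p_scale c x)"
proof -
  have v: "(c *s w) v* A = c *s (w v* A)" for w and A :: "(complex ^ 2) ^ 2"
    by (simp add: vector_matrix_mult_def vec_eq_iff sum_distrib_left mult_ac)
  have "p_scale c (act x g) = act (p_scale c x) g" for g
    by (cases x; cases g)
      (simp add: p_scale_def act_def vec_eq_iff v mult_ac)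
  then show ?thesis
    by (simp add: cstar_def orbit_def image_image)
qed

lemma matrix_inv_unique:
  fixes A B :: "(complex ^ 2) ^ 2"
  assumes "B ** A = mat 1" "A ** B = mat 1"
  shows "matrix_inv A = B"
proof -
  have "A ** matrix_inv A = mat 1 \<and> matrix_inv A ** A = mat 1"
    unfolding matrix_inv_def by (rule someI[of _ B]) (use assms in simp)
  then show ?thesis
    by (metis assms(1) matrix_mul_assoc matrix_mul_lid matrix_mul_rid)
qed

lemma G_reps_inv:
  assumes "(A, e) \<in> G_reps"
  shows "A ** matrix_inv A = mat 1" "matrix_inv A ** A = mat 1"
proof -
  have "invertible A" using assms by (simp add: G_reps_def invertible_det_nz)
  then obtain B where "A ** B = mat 1 \<and> B ** A = mat 1"
    unfolding invertible_def by blast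
  then have "A ** matrix_inv A = mat 1 \<and> matrix_inv A ** A = mat 1"
    unfolding matrix_inv_def by (rule someI)
  then show "A ** matrix_inv A = mat 1" "matrix_inv A ** A = mat 1"
    by simp_all
qed

lemma act_Z2:
  assumes "(A, e) \<in> G_reps"
  shows "act x (- A, \<lambda>i. - e i) = act x (A, e)"
proof -
  have m: "(- B) ** (- C) = B ** C" for B C :: "(complex ^ 2) ^ 2"
    by (simp add: matrix_matrix_mult_def vec_eq_iff)
  have "matrix_inv (- A) = - matrix_inv A"
    by (rule matrix_inv_unique) (simp_all add: m G_reps_inv[OF assms])
  moreover have "(- B) *v ((- c) *s v) = B *v (c *s v)" for B :: "(complex ^ 2) ^ 2" and c v
    by (simp add: matrix_vector_mult_def vec_eq_iff)
  moreover have "(- c) *s (w v* (- B)) = c *s (w v* B)" for B :: "(complex ^ 2) ^ 2" and c w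
    by (simp add: vector_matrix_mult_def vec_eq_iff sum_negf)
  ultimately show ?thesis
    by (cases x) (simp add: act_def)
qed

lemma act_act:
  assumes "(A, e) \<in> G_reps" "(B, f) \<in> G_reps"
  shows "act (act x (A, e)) (B, f) = act x (A ** B, \<lambda>i. e i * f i)"
proof -
  have "(matrix_inv B ** matrix_inv A) ** (A ** B) = mat 1"
    by (metis G_reps_inv(2) assms matrix_mul_assoc matrix_mul_lid)
  moreover have "(A ** B) ** (matrix_inv B ** matrix_inv A) = mat 1"
    by (metis G_reps_inv(1) assms matrix_mul_assoc matrix_mul_lid)
  ultimately have inv: "matrix_inv (A ** B) = matrix_inv B ** matrix_inv A"
    by (rule matrix_inv_unique)
  have v: "(c *s w) v* C = c *s (w v* C)" for c w and C :: "(complex ^ 2) ^ 2"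
    by (simp add: vector_matrix_mult_def vec_eq_iff sum_distrib_left mult_ac)
  show ?thesis
    by (cases x) (simp add: act_def inv v vec_eq_iff vector_matrix_mul_assoc vector_scalar_commute
        matrix_vector_mul_assoc mult_ac)
qed

end

theory Submission
  imports Defs
begin

text \<open>
  Let \<open>wedge u v\<close> be the determinant of two column vectors. At a point of the level set each
  \<open>p\<^sub>i\<close> annihilates the nonzero vector \<open>q\<^sub>i\<close>, so it is \<open>w\<^sub>i\<close> times the functional
  \<open>wedge q\<^sub>i\<close> for a unique number \<open>w\<^sub>i\<close>. In terms of \<open>(w, q)\<close> the moment map equation says that
  the symmetric matrix \<open>\<Sum>\<^sub>i w\<^sub>i q\<^sub>i q\<^sub>i\<^sup>T\<close> vanishes, and orbits are the same for \<open>GL\<^sub>2\<close> as for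
  \<open>SL\<^sub>2\<close>: a matrix \<open>B\<close> and scalars \<open>e\<^sub>i\<close> send \<open>q\<^sub>i\<close> to \<open>e\<^sub>i B q\<^sub>i\<close> and \<open>w\<^sub>i\<close> to
  \<open>w\<^sub>i / (e\<^sub>i\<^sup>2 det B)\<close> (\<open>moment_map_conormal_point\<close>, \<open>orbit_conormal_point\<close>). Let \<open>Y\<close> be the set
  of orbits for which \<open>S\<close> is straight and \<open>p\<close> vanishes off \<open>S\<close>; this is \<open>core_set\<close> below.

  The closure is \<open>Y\<close>. Vanishing of determinants and of the \<open>p\<^sub>j\<close> are closed conditions, so \<open>Y\<close> is
  closed. If \<open>\<lambda>\<cdot>[p, q]\<close> converges to a point of \<open>X\<^sub>S\<close>, then the invariant functions
  \<open>(p\<^sub>c q\<^sub>j) wedge q\<^sub>c q\<^sub>i / wedge q\<^sub>i q\<^sub>j\<close> and \<open>(p\<^sub>j q\<^sub>c) (p\<^sub>c q\<^sub>j)\<close> stay bounded along the curve;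
  being homogeneous of positive degree in \<open>p\<close> they are zero. With \<open>c \<in> S\<close> such that \<open>p\<^sub>c \<noteq> 0\<close> at the
  limit, and with \<open>i \<in> S\<close> and \<open>j \<notin> S\<close> arbitrary, this puts the orbit into \<open>Y\<close>
  (\<open>limit_in_fixed_component_imp_core\<close>). Conversely, a
  point of \<open>Y\<close> with \<open>p \<noteq> 0\<close> and with no \<open>q\<^sub>j\<close>, \<open>j \<notin> S\<close>, on the line of \<open>S\<close> flows into \<open>X\<^sub>S\<close>: a
  diagonal matrix undoes the scaling of \<open>p\<close> and contracts the \<open>q\<^sub>j\<close> to a second line
  (\<open>transverse_limit\<close>). Such points are automatically stable, because a straight set outside which
  \<open>p\<close> vanishes is then contained in \<open>S\<close>; hence they can be reached from any point of \<open>Y\<close> by an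
  arbitrarily small deformation inside the level set (\<open>core_set_subset_closure\<close>).

  Smoothness. Near a point of \<open>Y\<close> choose \<open>a \<in> S\<close> and \<open>b \<notin> S\<close> with \<open>q\<^sub>a, q\<^sub>b\<close> independent and
  normalise these to the standard basis. The remaining torus is fixed with a third index \<open>c\<close>, either
  \<open>c \<in> S\<close> with \<open>p\<^sub>c \<noteq> 0\<close>, normalising \<open>w\<^sub>c = 1\<close>, or \<open>c \<notin> S\<close> with \<open>q\<^sub>c\<close> on a third line, normalising
  its slope to \<open>1\<close>; stability excludes that both fail. The slopes \<open>z\<^sub>i\<close> and weights \<open>w\<^sub>i\<close> for the
  other \<open>n - 3\<close> indices are then free: the off-diagonal moment equation reads
  \<open>w\<^sub>c z\<^sub>c = remainder\<close>, which gives whichever of \<open>w\<^sub>c, z\<^sub>c\<close> is not normalised, and the diagonal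
  equations give \<open>w\<^sub>a\<close> and \<open>w\<^sub>b\<close>. So there is a polynomial section over a linear space of dimension
  \<open>2 (n - 3)\<close>, inverse to invariant rational coordinates (\<open>orbit_slice_section_coords\<close>,
  \<open>coords_slice_section\<close>), and such a pair always yields a chart of the quotient
  (\<open>holomorphic_chart_of_slice\<close>). In it \<open>Y\<close> is given by \<open>z\<^sub>i = 0\<close> for \<open>i \<in> S\<close> and \<open>w\<^sub>j = 0\<close> for
  \<open>j \<notin> S\<close>, a linear space of dimension \<open>n - 3\<close> (\<open>in_core_iff_coords\<close>).
\<close>

section \<open>Determinants and annihilators in the plane\<close>

definition wedge :: "complex ^ 2 \<Rightarrow> complex ^ 2 \<Rightarrow> complex" where
  "wedge u v = u $ 1 * v $ 2 - u $ 2 * v $ 1"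

text \<open>
  The row vector that represents the functional \<open>wedge v\<close>; see \<open>row_col_perp\<close>.
\<close>

definition perp :: "complex ^ 2 \<Rightarrow> complex ^ 2" where
  "perp v = vector [- v $ 2, v $ 1]"

lemma vec2_eq_iff: "u = v \<longleftrightarrow> u $ 1 = v $ 1 \<and> u $ 2 = v $ 2" for u v :: "complex ^ 2"
  by (simp add: vec_eq_iff forall_2)

lemma row_col_expand: "row_col w v = w $ 1 * v $ 1 + w $ 2 * v $ 2"
  by (simp add: row_col_def sum_2)

lemma row_col_perp: "row_col (perp u) v = wedge u v"
  by (simp add: row_col_expand perp_def wedge_def)

lemma wedge_self [simp]: "wedge u u = 0"
  by (simp add: wedge_def)

lemma wedge_swap: "wedge u v = - wedge v u"
  by (simp add: wedge_def)

lemma wedge_scale [simp]: "wedge (c *s u) v = c * wedge u v" "wedge u (c *s v) = c * wedge u v"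
  by (simp_all add: wedge_def algebra_simps)

lemma wedge_add [simp]:
  "wedge (u + u') v = wedge u v + wedge u' v" "wedge u (v + v') = wedge u v + wedge u v'"
  by (simp_all add: wedge_def algebra_simps)

lemma row_col_scale [simp]:
  "row_col (c *s u) v = c * row_col u v" "row_col u (c *s v) = c * row_col u v"
  by (simp_all add: row_col_expand algebra_simps)

lemma row_col_zero [simp]: "row_col 0 v = 0"
  by (simp add: row_col_expand)

lemma wedge_eq_0_imp_proportional:
  assumes "wedge u v = 0" "u \<noteq> 0"
  shows "\<exists>c. v = c *s u"
proof (cases "u $ 1 = 0")
  case True
  then show ?thesis using assms
    by (intro exI[of _ "v $ 2 / u $ 2"]) (auto simp: vec2_eq_iff wedge_def field_simps)
next
  case False
  then show ?thesis using assms
    by (intro exI[of _ "v $ 1 / u $ 1"]) (auto simp: vec2_eq_iff wedge_def field_simps)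
qed

lemma wedge_eq_0_trans:
  assumes "wedge u v = 0" "wedge v w = 0" "v \<noteq> 0"
  shows "wedge u w = 0"
proof -
  obtain c where "w = c *s v" using wedge_eq_0_imp_proportional assms by blast
  then show ?thesis using assms by simp
qed

lemma straight_iff_wedge:
  assumes "\<And>i. i \<in> S \<Longrightarrow> q $ i \<noteq> 0"
  shows "straight q S \<longleftrightarrow> (\<forall>i\<in>S. \<forall>j\<in>S. wedge (q $ i) (q $ j) = 0)"
  unfolding straight_def
proof (intro iffI ballI)
  fix i j assume *: "\<forall>i\<in>S. \<forall>j\<in>S. \<exists>c. q $ i = c *s q $ j" "i \<in> S" "j \<in> S"
  then obtain c where "q $ i = c *s q $ j" by blast
  then show "wedge (q $ i) (q $ j) = 0" by simp
next
  fix i j assume "\<forall>i\<in>S. \<forall>j\<in>S. wedge (q $ i) (q $ j) = 0" "i \<in> S" "j \<in> S"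
  then show "\<exists>c. q $ i = c *s q $ j" by (intro wedge_eq_0_imp_proportional) (auto simp: assms)
qed

lemma wedge_frame:
  "wedge u v *s w = wedge w v *s u + wedge u w *s v"
  by (simp add: vec2_eq_iff wedge_def algebra_simps)

lemma row_col_eq_0_imp_perp:
  assumes "row_col p q = 0" "q \<noteq> 0"
  shows "\<exists>w. p = w *s perp q"
proof -
  have "wedge (perp q) p = - row_col p q"
    by (simp add: wedge_def perp_def row_col_expand algebra_simps)
  then have "wedge (perp q) p = 0" using assms by simp
  moreover have "perp q \<noteq> 0" using assms by (auto simp: vec2_eq_iff perp_def)
  ultimately show ?thesis by (rule wedge_eq_0_imp_proportional)
qed

lemma perp_eq_0_iff [simp]: "perp u = 0 \<longleftrightarrow> u = 0"
  by (auto simp: vec2_eq_iff perp_def)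

section \<open>The group orbits\<close>

lemma matrix_vector_mult_scale: "B *v (c *s v) = c *s (B *v v)" for B :: "(complex ^ 2) ^ 2"
  by (simp add: vec2_eq_iff matrix_vector_mult_def sum_2 algebra_simps)

lemma vector_matrix_mult_scale: "(c *s v) v* B = c *s (v v* B)" for B :: "(complex ^ 2) ^ 2"
  by (simp add: vec2_eq_iff vector_matrix_mult_def sum_2 algebra_simps)

lemma wedge_matrix: "wedge (B *v u) (B *v v) = det B * wedge u v"
  by (simp add: wedge_def matrix_vector_mult_def sum_2 det_2 algebra_simps)

lemma row_col_matrix: "row_col (u v* A) v = row_col u (A *v v)"
  by (simp add: row_col_expand matrix_vector_mult_def vector_matrix_mult_def sum_2 algebra_simps)

lemma G_reps_one: "(mat 1, \<lambda>_. 1) \<in> G_reps"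
  by (simp add: G_reps_def)

lemma G_reps_mult:
  "\<lbrakk>(A, e) \<in> G_reps; (B, f) \<in> G_reps\<rbrakk> \<Longrightarrow> (A ** B, \<lambda>i. e i * f i) \<in> G_reps"
  by (simp add: G_reps_def det_mul)

lemma det_matrix_inv_G:
  assumes "(A, e) \<in> G_reps"
  shows "det (matrix_inv A) = 1"
proof -
  have "det A * det (matrix_inv A) = det (mat 1 :: (complex ^ 2) ^ 2)"
    by (metis G_reps_inv(1)[OF assms] det_mul)
  then show ?thesis using assms by (simp add: G_reps_def)
qed

lemma act_one: "act x (mat 1, \<lambda>_. 1) = x"
proof -
  have "matrix_inv (mat 1 :: (complex ^ 2) ^ 2) = mat 1"
    by (rule matrix_inv_unique) simp_all
  then show ?thesis by (cases x) (simp add: act_def)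
qed

lemma self_in_orbit: "x \<in> orbit x"
  unfolding orbit_def by (rule image_eqI[OF _ G_reps_one]) (simp add: act_one)

lemma orbit_act:
  assumes "g \<in> G_reps"
  shows "orbit (act x g) = orbit x"
proof -
  obtain A e where g: "g = (A, e)" "(A, e) \<in> G_reps" using assms by (cases g) auto
  define h where "h = (matrix_inv A, \<lambda>i. inverse (e i))"
  have h: "h \<in> G_reps"
    using g det_matrix_inv_G[OF g(2)] by (auto simp: h_def G_reps_def)
  have sub: "orbit (act y k) \<subseteq> orbit y" if "k \<in> G_reps" for k and y :: "'a pt"
    using that act_act[of "fst k" "snd k" _ _ y] G_reps_mult[of "fst k" "snd k"]
    by (force simp: orbit_def)
  have "act (act x g) h = act x (A ** matrix_inv A, \<lambda>i. e i * inverse (e i))"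
    using h g by (simp add: h_def act_act)
  also have "\<dots> = x"
    using g by (simp add: G_reps_inv[OF g(2)] G_reps_def act_one)
  finally have "orbit x \<subseteq> orbit (act x g)" using sub[OF h, of "act x g"] by simp
  with sub[OF assms, of x] show ?thesis by blast
qed

text \<open>
  All invariance statements are read off from this rule: pairings of the vectors change only by the
  scalars \<open>e\<close>, since elements of \<open>SL\<^sub>2\<close> preserve both \<open>wedge\<close> and the pairing of rows with columns.
\<close>

lemma orbit_eqE:
  fixes x y :: "'n::finite pt"
  assumes "orbit x = orbit y"
  obtains e where "\<And>i. e i \<noteq> 0"
    "\<And>i j. wedge (snd y $ i) (snd y $ j) = e i * e j * wedge (snd x $ i) (snd x $ j)"
    "\<And>i j. row_col (fst y $ i) (snd y $ j) = e j / e i * row_col (fst x $ i) (snd x $ j)"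
    "\<And>i. snd y $ i = 0 \<longleftrightarrow> snd x $ i = 0"
    "\<And>i. fst y $ i = 0 \<longleftrightarrow> fst x $ i = 0"
proof -
  have "y \<in> orbit x" using assms self_in_orbit by blast
  then obtain A e where g: "(A, e) \<in> G_reps" and y: "y = act x (A, e)"
    by (auto simp: orbit_def)
  note inv = G_reps_inv[OF g]
  have e: "e i \<noteq> 0" for i using g by (simp add: G_reps_def)
  have q: "snd y $ i = e i *s (matrix_inv A *v snd x $ i)" for i
    by (cases x) (simp add: y act_def matrix_vector_mult_scale)
  have p: "fst y $ i = inverse (e i) *s (fst x $ i v* A)" for i
    by (cases x) (simp add: y act_def)
  have q': "A *v (matrix_inv A *v v) = v" for v
    by (simp add: matrix_vector_mul_assoc inv)
  have p': "(v v* A) v* matrix_inv A = v" for v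
    by (simp add: vector_matrix_mul_assoc inv)
  show thesis
  proof
    show "e i \<noteq> 0" for i by (rule e)
    show "wedge (snd y $ i) (snd y $ j) = e i * e j * wedge (snd x $ i) (snd x $ j)" for i j
      by (simp add: q wedge_matrix det_matrix_inv_G[OF g])
    show "row_col (fst y $ i) (snd y $ j) = e j / e i * row_col (fst x $ i) (snd x $ j)" for i j
      by (simp add: q p row_col_matrix q' divide_simps e)
    have "matrix_inv A *v v = 0 \<longleftrightarrow> v = 0" for v by (metis q' matrix_vector_mult_0_right)
    then show "snd y $ i = 0 \<longleftrightarrow> snd x $ i = 0" for i using e by (simp add: q)
    have "v v* A = 0 \<longleftrightarrow> v = 0" for v by (metis p' vector_matrix_mult_0)
    then show "fst y $ i = 0 \<longleftrightarrow> fst x $ i = 0" for i using e by (simp add: p)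
  qed
qed

text \<open>
  Once all \<open>q\<^sub>i\<close> are nonzero, straightness is the vanishing of determinants, which is a closed condition
  and visibly invariant.
\<close>

lemma stable_iff_wedge:
  "stable \<alpha> x \<longleftrightarrow> (\<forall>i. snd x $ i \<noteq> 0) \<and>
     (\<forall>S. (\<forall>i\<in>S. \<forall>j\<in>S. wedge (snd x $ i) (snd x $ j) = 0) \<and> (\<forall>j\<in>- S. fst x $ j = 0)
        \<longrightarrow> short \<alpha> S)"
  by (cases x) (auto simp: stable_def straight_iff_wedge)

lemma stable_orbit:
  assumes "orbit x = orbit y" "stable \<alpha> x"
  shows "stable \<alpha> y"
proof -
  from assms(1) obtain e where *: "\<And>i. e i \<noteq> 0"
    "\<And>i j. wedge (snd y $ i) (snd y $ j) = e i * e j * wedge (snd x $ i) (snd x $ j)"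
    "\<And>i. snd y $ i = 0 \<longleftrightarrow> snd x $ i = 0"
    "\<And>i. fst y $ i = 0 \<longleftrightarrow> fst x $ i = 0"
    by (rule orbit_eqE) blast
  show ?thesis using assms(2) by (simp add: stable_iff_wedge *)
qed

text \<open>
  The pair \<open>(w, q)\<close> stands for the point whose rows are conormal to the lines spanned by the
  \<open>q\<^sub>i\<close>. Every point of the level set has this form.
\<close>

definition conormal_point :: "('n::finite \<Rightarrow> complex) \<Rightarrow> (complex ^ 2) ^ 'n \<Rightarrow> 'n pt" where
  "conormal_point w q = (\<chi> i. w i *s perp (q $ i), q)"

lemma conormal_point_sel [simp]:
  "snd (conormal_point w q) = q" "fst (conormal_point w q) $ i = w i *s perp (q $ i)"
  by (simp_all add: conormal_point_def)

text \<open>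
  For \<open>p = w perp q\<close> the matrix \<open>q p\<close> is already traceless, and up to a permutation and signs of its
  entries it is \<open>w q q\<^sup>T\<close>; the three equations are the entries of the sum of these symmetric matrices.
\<close>

lemma moment_map_conormal_point:
  "moment_map (conormal_point w q) = 0 \<longleftrightarrow>
     (\<Sum>i\<in>UNIV. w i * (q $ i $ 1)\<^sup>2) = 0 \<and> (\<Sum>i\<in>UNIV. w i * (q $ i $ 1 * q $ i $ 2)) = 0 \<and>
     (\<Sum>i\<in>UNIV. w i * (q $ i $ 2)\<^sup>2) = 0"
proof -
  have tf: "tracefree (outer (q $ i) (w i *s perp (q $ i)))
      = vector [vector [- (w i * (q $ i $ 1 * q $ i $ 2)), w i * (q $ i $ 1)\<^sup>2],
                vector [- (w i * (q $ i $ 2)\<^sup>2), w i * (q $ i $ 1 * q $ i $ 2)]]" for i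
    by (simp add: tracefree_def outer_def trace_def sum_2 vec_eq_iff forall_2 mat_def perp_def
        power2_eq_square algebra_simps)
  have eq: "moment_map (conormal_point w q) =
     (\<Sum>i\<in>UNIV. vector [vector [- (w i * (q $ i $ 1 * q $ i $ 2)), w i * (q $ i $ 1)\<^sup>2],
                vector [- (w i * (q $ i $ 2)\<^sup>2), w i * (q $ i $ 1 * q $ i $ 2)]], 0)"
    by (simp add: moment_map_def conormal_point_def tf vec_eq_iff row_col_perp)
  show ?thesis
    unfolding eq by (auto simp: zero_prod_def vec_eq_iff forall_2 sum_negf)
qed

lemma level_set_conormal:
  assumes "x \<in> level_set \<alpha>"
  obtains w where "x = conormal_point w (snd x)"
proof -
  obtain p q where x: "x = (p, q)" by (cases x)
  have "row_col (p $ i) (q $ i) = 0" "q $ i \<noteq> 0" for i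
    using assms by (auto simp: x level_set_def moment_map_def stable_def zero_prod_def vec_eq_iff)
  then have "\<forall>i. \<exists>w. p $ i = w *s perp (q $ i)" by (blast intro: row_col_eq_0_imp_perp)
  then obtain w where "\<And>i. p $ i = w i *s perp (q $ i)" by metis
  then show thesis by (intro that[of w]) (simp add: x conormal_point_def vec_eq_iff)
qed

text \<open>
  Matrices of arbitrary nonzero determinant may be used to move within an orbit: a square root of
  \<open>det B\<close> can be shifted from the matrix into the scalars. This avoids choosing
  square roots in explicit normal forms. The weights transform as stated because
  \<open>wedge (B u) (B v) = det B * wedge u v\<close>.
\<close>

lemma orbit_conormal_point:
  fixes q q' :: "(complex ^ 2) ^ 'n::finite"
  assumes B: "det B \<noteq> 0" and e: "\<And>i. e i \<noteq> 0"
    and q: "\<And>i. q' $ i = e i *s (B *v q $ i)" and w: "\<And>i. w i = w' i * (e i)\<^sup>2 * det B"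
  shows "orbit (conormal_point w' q') = orbit (conormal_point w q)"
proof -
  define s where "s = csqrt (det B)"
  have s: "s * s = det B" "s \<noteq> 0" using B by (auto simp: s_def simp flip: power2_eq_square)
  define A :: "(complex ^ 2) ^ 2" where
    "A = vector [vector [B $ 2 $ 2 / s, - (B $ 1 $ 2) / s], vector [- (B $ 2 $ 1) / s, B $ 1 $ 1 / s]]"
  define C :: "(complex ^ 2) ^ 2" where
    "C = vector [vector [B $ 1 $ 1 / s, B $ 1 $ 2 / s], vector [B $ 2 $ 1 / s, B $ 2 $ 2 / s]]"
  have dB: "B $ 1 $ 1 * B $ 2 $ 2 - B $ 1 $ 2 * B $ 2 $ 1 = s * s" by (simp add: s det_2)
  then have dB': "B $ 1 $ 1 * B $ 2 $ 2 = s * s + B $ 1 $ 2 * B $ 2 $ 1" by (simp add: algebra_simps)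
  have "det A = 1" using s(2) dB' by (simp add: A_def det_2 field_simps)
  then have g: "(A, \<lambda>i. e i * s) \<in> G_reps" using e s by (simp add: G_reps_def)
  have inv: "matrix_inv A = C"
    by (rule matrix_inv_unique)
      (use s(2) dB' in \<open>simp_all add: A_def C_def matrix_matrix_mult_def vec_eq_iff forall_2 sum_2
        mat_def field_simps\<close>)
  have "conormal_point w' q' = act (conormal_point w q) (A, \<lambda>i. e i * s)"
  proof -
    have "e i *s (B *v v) = C *v ((e i * s) *s v)" for i v
      using s(2) by (simp add: vec2_eq_iff matrix_vector_mult_def sum_2 C_def field_simps)
    moreover have "w' i *s perp (e i *s (B *v v)) = inverse (e i * s) *s (w i *s perp v v* A)" for i v
    proof -
      have "w' i *s perp (e i *s (B *v v)) = (w' i * e i) *s perp (B *v v)"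
        by (simp add: vec2_eq_iff perp_def)
      also have "perp (B *v v) = s *s (perp v v* A)"
        using s(2) by (simp add: vec2_eq_iff perp_def matrix_vector_mult_def vector_matrix_mult_def
            sum_2 A_def algebra_simps)
      also have "(w' i * e i) *s (s *s (perp v v* A)) = inverse (e i * s) *s (w i *s perp v v* A)"
        using s(2) e[of i]
        by (simp add: w s(1)[symmetric] vector_matrix_mult_scale power2_eq_square vec2_eq_iff field_simps)
      finally show ?thesis .
    qed
    ultimately show ?thesis
      by (simp add: conormal_point_def act_def inv q vec_eq_iff)
  qed
  then show ?thesis using orbit_act[OF g] by metis
qed

section \<open>Complex differentiability at a point\<close>

text \<open>
  The pointwise condition in \<open>holomorphic_in\<close>, isolated so that it can be shown to be stable under the
  arithmetic operations and under composition.
\<close>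

definition cdiff ::
  "(complex \<Rightarrow> 'v \<Rightarrow> 'v) \<Rightarrow> 'v::real_normed_vector set \<Rightarrow> 'v \<Rightarrow> ('v \<Rightarrow> complex) \<Rightarrow> bool"
where
  "cdiff sc E x f \<longleftrightarrow> (\<exists>D. (f has_derivative D) (at x within E) \<and>
     (\<forall>c. \<forall>u\<in>E. D (sc c u) = c * D u))"

lemma holomorphic_in_iff: "holomorphic_in sc E V f \<longleftrightarrow> (\<forall>x\<in>V. cdiff sc E x f)"
  by (simp add: holomorphic_in_def cdiff_def)

lemma cdiff_const [intro]: "cdiff sc E x (\<lambda>_. k)"
  unfolding cdiff_def by (rule exI[of _ "\<lambda>_. 0"]) simp

lemma cdiff_add [intro]:
  assumes "cdiff sc E x f" "cdiff sc E x g" shows "cdiff sc E x (\<lambda>y. f y + g y)"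
proof -
  obtain D D' where "(f has_derivative D) (at x within E)" "\<forall>c. \<forall>u\<in>E. D (sc c u) = c * D u"
    "(g has_derivative D') (at x within E)" "\<forall>c. \<forall>u\<in>E. D' (sc c u) = c * D' u"
    using assms unfolding cdiff_def by blast
  then show ?thesis unfolding cdiff_def
    by (intro exI[of _ "\<lambda>u. D u + D' u"] conjI has_derivative_add) (auto simp: algebra_simps)
qed

lemma cdiff_mult [intro]:
  assumes "cdiff sc E x f" "cdiff sc E x g" shows "cdiff sc E x (\<lambda>y. f y * g y)"
proof -
  obtain D D' where "(f has_derivative D) (at x within E)" "\<forall>c. \<forall>u\<in>E. D (sc c u) = c * D u"
    "(g has_derivative D') (at x within E)" "\<forall>c. \<forall>u\<in>E. D' (sc c u) = c * D' u"
    using assms unfolding cdiff_def by blast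
  then show ?thesis unfolding cdiff_def
    by (intro exI[of _ "\<lambda>u. f x * D' u + D u * g x"] conjI has_derivative_mult)
      (auto simp: algebra_simps)
qed

lemma cdiff_minus [intro]:
  assumes "cdiff sc E x f" shows "cdiff sc E x (\<lambda>y. - f y)"
  using cdiff_mult[OF cdiff_const[of _ _ _ "- 1"] assms] by simp

lemma cdiff_diff [intro]:
  assumes "cdiff sc E x f" "cdiff sc E x g" shows "cdiff sc E x (\<lambda>y. f y - g y)"
  using cdiff_add[OF assms(1) cdiff_minus[OF assms(2)]] by simp

lemma cdiff_inverse [intro]:
  assumes "cdiff sc E x f" "f x \<noteq> 0" shows "cdiff sc E x (\<lambda>y. inverse (f y))"
proof -
  obtain D where D: "(f has_derivative D) (at x within E)" "\<forall>c. \<forall>u\<in>E. D (sc c u) = c * D u"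
    using assms unfolding cdiff_def by blast
  show ?thesis unfolding cdiff_def
    using Deriv.has_derivative_inverse[OF assms(2) D(1)] D(2)
    by (intro exI[of _ "\<lambda>u. - (inverse (f x) * D u * inverse (f x))"] conjI) simp_all
qed

lemma cdiff_divide [intro]:
  assumes "cdiff sc E x f" "cdiff sc E x g" "g x \<noteq> 0" shows "cdiff sc E x (\<lambda>y. f y / g y)"
  using cdiff_mult[OF assms(1) cdiff_inverse[OF assms(2,3)]] by (simp add: divide_inverse)

lemma cdiff_power [intro]: "cdiff sc E x f \<Longrightarrow> cdiff sc E x (\<lambda>y. f y ^ k)"
  by (induction k) auto

lemma cdiff_sum [intro]:
  "(\<And>i. i \<in> I \<Longrightarrow> cdiff sc E x (f i)) \<Longrightarrow> cdiff sc E x (\<lambda>y. \<Sum>i\<in>I. f i y)"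
  by (induction I rule: infinite_finite_induct) auto

lemma cdiff_continuous:
  assumes "cdiff sc E x f" shows "continuous (at x within E) f"
  using assms has_derivative_continuous unfolding cdiff_def by blast

lemma cdiff_vec_nth [intro]: "cdiff (*s) E x (\<lambda>v::complex ^ 'm::finite. v $ k)"
  unfolding cdiff_def
  by (rule exI[of _ "\<lambda>u. u $ k"])
    (auto intro!: bounded_linear_imp_has_derivative bounded_linear_vec_nth)

lemma cdiff_pt_coord [intro]:
  "cdiff pt_scale E x (\<lambda>y::'n::finite pt. fst y $ i $ a)"
  "cdiff pt_scale E x (\<lambda>y::'n::finite pt. snd y $ i $ a)"
  unfolding cdiff_def
   apply (rule exI[of _ "\<lambda>u. fst u $ i $ a"])
   apply (auto intro!: bounded_linear_imp_has_derivative
      bounded_linear_compose[OF bounded_linear_vec_nth] bounded_linear_fst simp: pt_scale_def)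
  apply (rule exI[of _ "\<lambda>u. snd u $ i $ a"])
  apply (auto intro!: bounded_linear_imp_has_derivative
      bounded_linear_compose[OF bounded_linear_vec_nth] bounded_linear_snd simp: pt_scale_def)
  done

lemma has_derivative_vec_lambda:
  fixes f :: "'v::real_normed_vector \<Rightarrow> 'b::euclidean_space ^ 'm::finite"
  assumes "\<And>k. ((\<lambda>y. f y $ k) has_derivative D k) (at x within E)"
  shows "(f has_derivative (\<lambda>u. \<chi> k. D k u)) (at x within E)"
  unfolding has_derivative_componentwise_within[of f]
proof
  fix b :: "'b ^ 'm" assume "b \<in> Basis"
  then obtain k c where "b = axis k c" "c \<in> Basis" by (auto simp: Basis_vec_def)
  then show "((\<lambda>y. f y \<bullet> b) has_derivative (\<lambda>u. (\<chi> k. D k u) \<bullet> b)) (at x within E)"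
    by (simp add: inner_axis has_derivative_inner_left assms)
qed

text \<open>
  The derivative of the outer function is only known to be complex linear on the coordinate subspace
  \<open>E\<close>; this suffices because the derivative of \<open>f\<close> also takes values in \<open>E\<close>. To see the latter, the
  zero derivative is chosen for the components that vanish identically.
\<close>

lemma cdiff_compose_vec:
  fixes f :: "'v::real_normed_vector \<Rightarrow> complex ^ 'm::finite"
  assumes f: "\<And>k. k \<in> K \<Longrightarrow> cdiff sc UNIV x (\<lambda>y. f y $ k)"
    and E: "E = {v. \<forall>k. k \<notin> K \<longrightarrow> v $ k = 0}" and fE: "\<And>y. f y \<in> E"
    and g: "cdiff (*s) E (f x) g"
  shows "cdiff sc UNIV x (g \<circ> f)"
proof -
  have "\<forall>k. \<exists>D. ((\<lambda>y. f y $ k) has_derivative D) (at x) \<and> (\<forall>c u. D (sc c u) = c * D u) \<and>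
      (k \<notin> K \<longrightarrow> D = (\<lambda>_. 0))"
  proof
    fix k
    show "\<exists>D. ((\<lambda>y. f y $ k) has_derivative D) (at x) \<and> (\<forall>c u. D (sc c u) = c * D u) \<and>
      (k \<notin> K \<longrightarrow> D = (\<lambda>_. 0))"
    proof (cases "k \<in> K")
      case True
      then show ?thesis using f[OF True] unfolding cdiff_def by auto
    next
      case False
      then have "(\<lambda>y. f y $ k) = (\<lambda>_. 0)" using fE by (auto simp: E)
      then show ?thesis by (intro exI[of _ "\<lambda>_. 0"]) simp
    qed
  qed
  then obtain D where D: "\<And>k. ((\<lambda>y. f y $ k) has_derivative D k) (at x)"
    "\<And>k c u. D k (sc c u) = c * D k u" "\<And>k u. k \<notin> K \<Longrightarrow> D k u = 0"
    by metis
  obtain D' where D': "(g has_derivative D') (at (f x) within E)"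
    "\<And>c u. u \<in> E \<Longrightarrow> D' (c *s u) = c * D' u"
    using g unfolding cdiff_def by blast
  have "(f has_derivative (\<lambda>u. \<chi> k. D k u)) (at x)" using D(1) by (rule has_derivative_vec_lambda)
  moreover have "(g has_derivative D') (at (f x) within range f)"
    by (rule has_derivative_subset[OF D'(1)]) (use fE in auto)
  ultimately have "((\<lambda>y. g (f y)) has_derivative (\<lambda>u. D' (\<chi> k. D k u))) (at x)"
    by (rule has_derivative_in_compose)
  moreover have "D' (\<chi> k. D k (sc c u)) = c * D' (\<chi> k. D k u)" for c u
  proof -
    have "(\<chi> k. D k (sc c u)) = c *s (\<chi> k. D k u)" by (simp add: vec_eq_iff D(2))
    then show ?thesis using D(3) by (simp add: D'(2) E)
  qed
  ultimately show ?thesis unfolding cdiff_def o_def by blast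
qed

lemma has_derivative_pt:
  fixes f :: "'v::real_normed_vector \<Rightarrow> 'n::finite pt"
  assumes "\<And>i a. ((\<lambda>y. fst (f y) $ i $ a) has_derivative D i a) (at x within E)"
    "\<And>i a. ((\<lambda>y. snd (f y) $ i $ a) has_derivative D' i a) (at x within E)"
  shows "(f has_derivative (\<lambda>u. (\<chi> i a. D i a u, \<chi> i a. D' i a u))) (at x within E)"
proof -
  have "((\<lambda>y. (fst (f y), snd (f y))) has_derivative (\<lambda>u. (\<chi> i a. D i a u, \<chi> i a. D' i a u)))
      (at x within E)"
    by (intro has_derivative_Pair has_derivative_vec_lambda assms)
  then show ?thesis by simp
qed

lemma cdiff_compose_pt:
  fixes f :: "complex ^ 'm::finite \<Rightarrow> 'n::finite pt"
  assumes p: "\<And>i a. cdiff (*s) E x (\<lambda>y. fst (f y) $ i $ a)"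
    and q: "\<And>i a. cdiff (*s) E x (\<lambda>y. snd (f y) $ i $ a)"
    and g: "cdiff pt_scale UNIV (f x) g"
  shows "cdiff (*s) E x (g \<circ> f)"
proof -
  obtain D where D: "\<And>i a. ((\<lambda>y. fst (f y) $ i $ a) has_derivative D i a) (at x within E)"
    "\<And>i a c u. u \<in> E \<Longrightarrow> D i a (c *s u) = c * D i a u"
    using p unfolding cdiff_def by metis
  obtain D' where D': "\<And>i a. ((\<lambda>y. snd (f y) $ i $ a) has_derivative D' i a) (at x within E)"
    "\<And>i a c u. u \<in> E \<Longrightarrow> D' i a (c *s u) = c * D' i a u"
    using q unfolding cdiff_def by metis
  obtain G where G: "(g has_derivative G) (at (f x))" "\<And>c u. G (pt_scale c u) = c * G u"
    using g unfolding cdiff_def by blast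
  have "((\<lambda>y. g (f y)) has_derivative (\<lambda>u. G (\<chi> i a. D i a u, \<chi> i a. D' i a u))) (at x within E)"
    by (rule has_derivative_compose[OF has_derivative_pt[OF D(1) D'(1)] G(1)])
  moreover have "G (\<chi> i a. D i a (c *s u), \<chi> i a. D' i a (c *s u))
      = c * G (\<chi> i a. D i a u, \<chi> i a. D' i a u)" if "u \<in> E" for c u
  proof -
    have "(\<chi> i a. D i a (c *s u), \<chi> i a. D' i a (c *s u))
      = pt_scale c (\<chi> i a. D i a u, \<chi> i a. D' i a u)"
      using that by (simp add: pt_scale_def vec_eq_iff D(2) D'(2))
    then show ?thesis by (simp add: G(2))
  qed
  ultimately show ?thesis unfolding cdiff_def o_def by blast
qed

lemma cdiff_transform:
  assumes "cdiff sc E x f" "openin (top_of_set E) V" "x \<in> V" "\<And>y. y \<in> V \<Longrightarrow> f y = g y"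
  shows "cdiff sc E x g"
proof -
  obtain T where T: "open T" "V = E \<inter> T" using assms(2) by (auto simp: openin_open)
  then obtain d where d: "d > 0" "\<And>y. dist y x < d \<Longrightarrow> y \<in> T"
    using assms(3) by (auto simp: open_dist)
  obtain D where "(f has_derivative D) (at x within E)" "\<forall>c. \<forall>u\<in>E. D (sc c u) = c * D u"
    using assms(1) unfolding cdiff_def by blast
  moreover from this have "(g has_derivative D) (at x within E)"
    using has_derivative_transform_within[of f D x E d g] d T assms(3,4) by auto
  ultimately show ?thesis unfolding cdiff_def by blast
qed

section \<open>Topology of the stable locus\<close>

lemma continuous_on_wedge [continuous_intros]:
  assumes "continuous_on A f" "continuous_on A g"
  shows "continuous_on A (\<lambda>x. wedge (f x) (g x))"
  unfolding wedge_def using assms by (auto intro!: continuous_intros)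

lemma continuous_on_row_col [continuous_intros]:
  assumes "continuous_on A f" "continuous_on A g"
  shows "continuous_on A (\<lambda>x. row_col (f x) (g x))"
  unfolding row_col_expand using assms by (auto intro!: continuous_intros)

text \<open>
  Instability is a finite union of closed conditions on the open set where all \<open>q\<^sub>i\<close> are
  nonzero, one for each subset that is not short.
\<close>

lemma open_stable: "open {x :: 'n::finite pt. stable \<alpha> x}"
proof -
  define C where "C = (\<lambda>S. {x :: 'n pt. (\<forall>i\<in>S. \<forall>j\<in>S. wedge (snd x $ i) (snd x $ j) = 0) \<and>
     (\<forall>j\<in>- S. fst x $ j = 0)})"
  have "closed (C S)" for S unfolding C_def Ball_def
    by (intro closed_Collect_conj closed_Collect_all closed_Collect_imp open_Collect_const
        closed_Collect_eq continuous_intros)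
  then have "closed (\<Union>S\<in>{S. \<not> short \<alpha> S}. C S)" by (intro closed_UN) auto
  moreover have "open {x :: 'n pt. \<forall>i. snd x $ i \<noteq> 0}"
    unfolding Collect_all_eq by (intro open_INT ballI open_Collect_neq continuous_intros) simp
  moreover have "{x :: 'n pt. stable \<alpha> x} =
      {x. \<forall>i. snd x $ i \<noteq> 0} - (\<Union>S\<in>{S. \<not> short \<alpha> S}. C S)"
    by (auto simp: stable_iff_wedge C_def)
  ultimately show ?thesis by (simp add: open_Diff)
qed

lemma continuous_map_orbit:
  "continuous_map (top_of_set (level_set \<alpha>)) (hyperpolygon_top \<alpha>) orbit"
  unfolding continuous_map_def topspace_hyperpolygon_top
  by (auto simp: hyperpolygon_space_def openin_hyperpolygon_top)

section \<open>Charts of the quotient from slices\<close>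

text \<open>
  A chart of the quotient can be checked entirely upstairs. Invariant holomorphic functions \<open>\<Phi>\<close> on a
  saturated open set descend to coordinates \<open>\<phi>\<close>, and a holomorphic section \<open>\<sigma>\<close> of them provides the
  inverse, as the orbit of \<open>\<sigma>\<close>. A function \<open>g\<close> of the coordinates pulls back to \<open>g \<circ> \<Phi>\<close>, which is
  defined on an open subset of the ambient space, so no extension has to be constructed; in the other
  direction \<open>g\<close> is recovered by composing an extension with \<open>\<sigma>\<close>. The image of the chart consists
  of the parameters for which \<open>\<sigma>\<close> is stable, and this is open since stability is.
\<close>

lemma holomorphic_chart_of_slice:
  fixes \<alpha> :: "'n::finite \<Rightarrow> real" and \<Phi> :: "'n pt \<Rightarrow> complex ^ ('n + 'n)"
    and \<sigma> :: "complex ^ ('n + 'n) \<Rightarrow> 'n pt" and N :: "'n pt set"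
  assumes E: "E = {v. \<forall>k. k \<notin> K \<longrightarrow> v $ k = 0}" and card: "card K = 2 * (CARD('n) - 3)"
    and N: "open N"
    and satN: "\<And>x y. \<lbrakk>x \<in> N; orbit x = orbit y\<rbrakk> \<Longrightarrow> y \<in> N"
    and inv: "\<And>x y. \<lbrakk>x \<in> N; orbit x = orbit y\<rbrakk> \<Longrightarrow> \<Phi> x = \<Phi> y"
    and \<Phi>E: "\<And>x. \<Phi> x \<in> E"
    and \<Phi>hol: "\<And>x k. \<lbrakk>x \<in> N; k \<in> K\<rbrakk> \<Longrightarrow> cdiff pt_scale UNIV x (\<lambda>y. \<Phi> y $ k)"
    and \<sigma>hol: "\<And>v i a. v \<in> E \<Longrightarrow> cdiff (*s) E v (\<lambda>y. fst (\<sigma> y) $ i $ a)"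
      "\<And>v i a. v \<in> E \<Longrightarrow> cdiff (*s) E v (\<lambda>y. snd (\<sigma> y) $ i $ a)"
    and \<sigma>0: "\<And>v. v \<in> E \<Longrightarrow> moment_map (\<sigma> v) = 0"
    and \<sigma>N: "\<And>v. v \<in> E \<Longrightarrow> \<sigma> v \<in> N"
    and \<Phi>\<sigma>: "\<And>v. v \<in> E \<Longrightarrow> \<Phi> (\<sigma> v) = v"
    and \<sigma>\<Phi>: "\<And>x. \<lbrakk>x \<in> N; x \<in> level_set \<alpha>\<rbrakk> \<Longrightarrow> orbit (\<sigma> (\<Phi> x)) = orbit x"
  shows "\<exists>\<phi>. holomorphic_chart \<alpha> (orbit ` (N \<inter> level_set \<alpha>)) E \<phi> \<and> (\<forall>x\<in>N. \<phi> (orbit x) = \<Phi> x)"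
proof -
  let ?L = "level_set \<alpha>" and ?X = "hyperpolygon_top \<alpha>"
  define W where "W = orbit ` (N \<inter> ?L)"
  define \<phi> where "\<phi> = (\<lambda>Y. \<Phi> (SOME x. orbit x = Y))"
  have \<phi>_orbit: "\<phi> (orbit x) = \<Phi> x" if "x \<in> N" for x
  proof -
    have "orbit (SOME y. orbit y = orbit x) = orbit x" by (rule someI) simp
    then show ?thesis unfolding \<phi>_def using inv[OF that] by metis
  qed
  have \<sigma>L: "\<sigma> v \<in> ?L" if "v \<in> E" "stable \<alpha> (\<sigma> v)" for v
    using that \<sigma>0 by (simp add: level_set_def)
  have stab: "stable \<alpha> (\<sigma> (\<Phi> x))" if "x \<in> N" "x \<in> ?L" for x
    using stable_orbit[OF \<sigma>\<Phi>[OF that, symmetric]] that by (simp add: level_set_def)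
  have img: "\<phi> ` W = {v \<in> E. stable \<alpha> (\<sigma> v)}"
  proof (intro set_eqI iffI)
    fix v assume "v \<in> \<phi> ` W"
    then obtain x where "x \<in> N" "x \<in> ?L" "v = \<Phi> x" by (auto simp: W_def \<phi>_orbit)
    then show "v \<in> {v \<in> E. stable \<alpha> (\<sigma> v)}" using \<Phi>E stab by auto
  next
    fix v assume v: "v \<in> {v \<in> E. stable \<alpha> (\<sigma> v)}"
    then have "orbit (\<sigma> v) \<in> W" using \<sigma>N \<sigma>L by (auto simp: W_def)
    moreover have "\<phi> (orbit (\<sigma> v)) = v" using v \<sigma>N \<Phi>\<sigma> by (simp add: \<phi>_orbit)
    ultimately show "v \<in> \<phi> ` W" by (metis imageI)
  qed
  have \<sigma>cont: "continuous_on E \<sigma>"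
  proof -
    have "continuous_on E (\<lambda>v. (\<chi> i a. fst (\<sigma> v) $ i $ a, \<chi> i a. snd (\<sigma> v) $ i $ a))"
      by (intro continuous_on_Pair continuous_on_vec_lambda)
        (auto simp: continuous_on_eq_continuous_within intro: cdiff_continuous \<sigma>hol)
    then show ?thesis by simp
  qed
  have \<Phi>cont: "continuous_on N \<Phi>"
  proof -
    have "continuous_on N (\<lambda>x. \<chi> k. \<Phi> x $ k)"
    proof (rule continuous_on_vec_lambda)
      fix k
      show "continuous_on N (\<lambda>x. \<Phi> x $ k)"
      proof (cases "k \<in> K")
        case True
        then show ?thesis using cdiff_continuous[OF \<Phi>hol]
          by (auto simp: continuous_on_eq_continuous_within intro: continuous_at_imp_continuous_at_within)
      next
        case False
        then have "\<Phi> x $ k = 0" for x using \<Phi>E by (auto simp: E)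
        then show ?thesis by simp
      qed
    qed
    then show ?thesis by simp
  qed
  have orbW: "orbit x \<in> W \<longleftrightarrow> x \<in> N" if "x \<in> ?L" for x
  proof
    assume "orbit x \<in> W"
    then obtain y where "y \<in> N" "orbit y = orbit x" by (auto simp: W_def)
    then show "x \<in> N" by (rule satN)
  qed (use that in \<open>simp add: W_def\<close>)
  have opW: "openin ?X W"
  proof -
    have "{x \<in> ?L. orbit x \<in> W} = ?L \<inter> N" using orbW by auto
    then show ?thesis using N
      by (auto simp: openin_hyperpolygon_top W_def hyperpolygon_space_def openin_open)
  qed
  have opimg: "openin (top_of_set E) (\<phi> ` W)"
  proof -
    have "\<phi> ` W = E \<inter> \<sigma> -` {x. stable \<alpha> x}" using img by auto
    then show ?thesis using continuous_openin_preimage_gen[OF \<sigma>cont open_stable] by simp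
  qed
  have op_pre: "openin ?X {Y \<in> W. \<phi> Y \<in> T}" if T: "open T" for T
  proof -
    have "{x \<in> ?L. orbit x \<in> {Y \<in> W. \<phi> Y \<in> T}} = ?L \<inter> (N \<inter> \<Phi> -` T)"
      using orbW \<phi>_orbit by auto
    moreover have "open (N \<inter> \<Phi> -` T)"
      using continuous_open_preimage[OF \<Phi>cont N T] .
    ultimately show ?thesis
      by (auto simp: openin_hyperpolygon_top W_def hyperpolygon_space_def openin_open)
  qed
  have topW: "topspace (subtopology ?X W) = W"
    using openin_subset[OF opW] by (auto simp: topspace_subtopology)
  have homeo: "homeomorphic_map (subtopology ?X W) (top_of_set (\<phi> ` W)) \<phi>"
    unfolding homeomorphic_map_maps homeomorphic_maps_def
  proof (intro exI[of _ "\<lambda>v. orbit (\<sigma> v)"] conjI ballI)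
    have "continuous_map (subtopology ?X W) euclidean \<phi>"
      unfolding continuous_map_def topW using op_pre
      by (auto simp: openin_subtopology intro: exI[of _ "{Y \<in> W. \<phi> Y \<in> _}"])
    then show "continuous_map (subtopology ?X W) (top_of_set (\<phi> ` W)) \<phi>"
      unfolding continuous_map_in_subtopology topW by simp
    have "continuous_map (top_of_set (\<phi> ` W)) (top_of_set ?L) \<sigma>"
      using \<sigma>cont continuous_on_subset[of E \<sigma> "\<phi> ` W"] \<sigma>L by (auto simp: img continuous_map_in_subtopology)
    then have "continuous_map (top_of_set (\<phi> ` W)) ?X (\<lambda>v. orbit (\<sigma> v))"
      using continuous_map_compose[OF _ continuous_map_orbit] unfolding o_def by blast
    moreover have "orbit (\<sigma> v) \<in> W" if "v \<in> \<phi> ` W" for v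
      using that unfolding img by (simp add: W_def \<sigma>N \<sigma>L)
    ultimately show "continuous_map (top_of_set (\<phi> ` W)) (subtopology ?X W) (\<lambda>v. orbit (\<sigma> v))"
      unfolding continuous_map_in_subtopology by auto
    show "orbit (\<sigma> (\<phi> Y)) = Y" if "Y \<in> topspace (subtopology ?X W)" for Y
      using that unfolding topW by (auto simp: W_def \<phi>_orbit \<sigma>\<Phi>)
    show "\<phi> (orbit (\<sigma> v)) = v" if "v \<in> topspace (top_of_set (\<phi> ` W))" for v
      using that \<sigma>N \<Phi>\<sigma> by (auto simp: img \<phi>_orbit)
  qed
  have sheaf: "holomorphic_in (*s) E V g \<longleftrightarrow>
      hyperpolygon_holomorphic \<alpha> {Y \<in> W. \<phi> Y \<in> V} (g \<circ> \<phi>)"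
    if V: "openin (top_of_set E) V" "V \<subseteq> \<phi> ` W" for V g
  proof -
    obtain T where T: "open T" "V = E \<inter> T" using V(1) by (auto simp: openin_open)
    define A where "A = {x \<in> ?L. orbit x \<in> {Y \<in> W. \<phi> Y \<in> V}}"
    have A: "A = ?L \<inter> {x \<in> N. \<Phi> x \<in> V}" unfolding A_def using orbW \<phi>_orbit by auto
    have "{Y \<in> W. \<phi> Y \<in> V} = {Y \<in> W. \<phi> Y \<in> T}" using T img by auto
    then have opA: "openin ?X {Y \<in> W. \<phi> Y \<in> V}" using op_pre T by simp
    have openN': "open {x \<in> N. \<Phi> x \<in> V}"
    proof -
      have "{x \<in> N. \<Phi> x \<in> V} = N \<inter> \<Phi> -` T" using T \<Phi>E by auto
      then show ?thesis using continuous_open_preimage[OF \<Phi>cont N T(1)] by simp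
    qed
    show ?thesis unfolding hyperpolygon_holomorphic_def A_def[symmetric]
    proof (intro iffI conjI opA)
      assume g: "holomorphic_in (*s) E V g"
      have "holomorphic_in pt_scale UNIV {x \<in> N. \<Phi> x \<in> V} (g \<circ> \<Phi>)"
        unfolding holomorphic_in_iff
      proof (intro ballI cdiff_compose_vec[where K = K, OF _ E \<Phi>E])
        fix x assume "x \<in> {x \<in> N. \<Phi> x \<in> V}"
        then show "cdiff pt_scale UNIV x (\<lambda>y. \<Phi> y $ k)" if "k \<in> K" for k
          using \<Phi>hol that by auto
        show "cdiff (*s) E (\<Phi> x) g"
          using g \<open>x \<in> {x \<in> N. \<Phi> x \<in> V}\<close> by (simp add: holomorphic_in_iff)
      qed
      then show "level_holomorphic A (g \<circ> \<phi> \<circ> orbit)"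
        unfolding level_holomorphic_def
        by (intro ballI exI[of _ "{x \<in> N. \<Phi> x \<in> V}"] exI[of _ "g \<circ> \<Phi>"])
          (use openN' A \<phi>_orbit in auto)
    next
      assume *: "openin ?X {Y \<in> W. \<phi> Y \<in> V} \<and> level_holomorphic A (g \<circ> \<phi> \<circ> orbit)"
      show "holomorphic_in (*s) E V g" unfolding holomorphic_in_iff
      proof
        fix v assume v: "v \<in> V"
        have VE: "u \<in> E" "\<sigma> u \<in> ?L" "\<sigma> u \<in> N" "\<Phi> (\<sigma> u) = u" if "u \<in> V" for u
          using that V(2) \<sigma>L \<sigma>N \<Phi>\<sigma> unfolding img by auto
        have \<sigma>A: "\<sigma> u \<in> A" if "u \<in> V" for u using VE[OF that] that by (simp add: A)
        obtain M F where M: "open M" "\<sigma> v \<in> M" "holomorphic_in pt_scale UNIV M F"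
          "\<And>y. y \<in> M \<inter> A \<Longrightarrow> F y = (g \<circ> \<phi> \<circ> orbit) y"
          using * \<sigma>A[OF v] unfolding level_holomorphic_def by blast
        have "cdiff (*s) E v (F \<circ> \<sigma>)"
          using M(2,3) VE[OF v] by (intro cdiff_compose_pt \<sigma>hol) (auto simp: holomorphic_in_iff)
        moreover have "openin (top_of_set E) (V \<inter> (E \<inter> \<sigma> -` M))"
          using V(1) continuous_openin_preimage_gen[OF \<sigma>cont M(1)] by (rule openin_Int)
        ultimately show "cdiff (*s) E v g"
        proof (rule cdiff_transform)
          show "v \<in> V \<inter> (E \<inter> \<sigma> -` M)" using v VE M by auto
          fix u assume u: "u \<in> V \<inter> (E \<inter> \<sigma> -` M)"
          then show "(F \<circ> \<sigma>) u = g u"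
            using M(4)[of "\<sigma> u"] \<sigma>A[of u] VE[of u] by (simp add: \<phi>_orbit)
        qed
      qed
    qed
  qed
  have "vec.subspace E"
    unfolding E vec.subspace_def by auto
  moreover have "vec.dim E = 2 * (CARD('n) - 3)"
    unfolding E dim_substandard_cart card ..
  ultimately have "holomorphic_chart \<alpha> W E \<phi>"
    unfolding holomorphic_chart_def using opW opimg homeo sheaf by blast
  then show ?thesis using \<phi>_orbit unfolding W_def by blast
qed

section \<open>The normal form adapted to S\<close>

text \<open>
  The condition that cuts out the core component. It agrees with straightness on the level set, and in
  this form it is meaningful, closed and invariant everywhere.
\<close>

definition in_core :: "'n::finite set \<Rightarrow> 'n pt \<Rightarrow> bool" where
  "in_core S x \<longleftrightarrow> (\<forall>i\<in>S. \<forall>j\<in>S. wedge (snd x $ i) (snd x $ j) = 0) \<and> (\<forall>j\<in>- S. fst x $ j = 0)"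

lemma in_core_orbit:
  assumes "orbit x = orbit y"
  shows "in_core S x \<longleftrightarrow> in_core S y"
proof -
  from assms obtain e where "\<And>i. e i \<noteq> 0"
    "\<And>i j. wedge (snd y $ i) (snd y $ j) = e i * e j * wedge (snd x $ i) (snd x $ j)"
    "\<And>i. fst y $ i = 0 \<longleftrightarrow> fst x $ i = 0"
    by (rule orbit_eqE) blast
  then show ?thesis by (simp add: in_core_def)
qed

lemma cdiff_wedge [intro]:
  "cdiff pt_scale E x (\<lambda>y::'n::finite pt. wedge (snd y $ i) (snd y $ j))"
  unfolding wedge_def by (intro cdiff_diff cdiff_mult cdiff_pt_coord)

lemma cdiff_row_col [intro]:
  "cdiff pt_scale E x (\<lambda>y::'n::finite pt. row_col (fst y $ i) (snd y $ j))"
  unfolding row_col_expand by (intro cdiff_add cdiff_mult cdiff_pt_coord)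

text \<open>
  The indices \<open>a\<close> and \<open>b\<close> provide the frame and \<open>c\<close> fixes the scale of the torus that
  remains: the weight at \<open>c\<close> is normalised if \<open>c \<in> S\<close>, the slope otherwise. The constants
  \<open>m i\<close> choose an affine chart of the projective line for each \<open>q\<^sub>i\<close>: the vector is scaled to
  \<open>(1 - m\<^sub>i z\<^sub>i, z\<^sub>i)\<close>, so that \<open>m\<^sub>i = 0\<close> misses the line of \<open>q\<^sub>b\<close> and \<open>m\<^sub>i = 1\<close> allows it.
\<close>

locale frame_slice =
  fixes S :: "'n::finite set" and a b c :: 'n and m :: "'n \<Rightarrow> complex"
  assumes a_in: "a \<in> S" and b_notin: "b \<notin> S" and c_distinct: "a \<noteq> c" "b \<noteq> c"
begin

lemma distinct: "a \<noteq> b" "a \<noteq> c" "b \<noteq> c"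
  using a_in b_notin c_distinct by auto

definition others :: "'n set" where "others = - {a, b, c}"

lemma sum_split: "sum f UNIV = f a + f b + f c + sum f others" for f :: "'n \<Rightarrow> complex"
proof -
  have "sum f UNIV = sum f others + sum f {a, b, c}"
    unfolding others_def by (metis Compl_eq_Diff_UNIV finite sum.subset_diff subset_UNIV)
  then show ?thesis using distinct by (simp add: add_ac)
qed

lemma card_others: "card others = CARD('n) - 3"
  using distinct by (simp add: others_def Compl_eq_Diff_UNIV card_Diff_subset)

text \<open>
  In a frame with \<open>q\<^sub>a\<close> and \<open>q\<^sub>b\<close> on the axes, the matrix
  \<open>v \<mapsto> (wedge v q\<^sub>b, wedge q\<^sub>a v / \<tau>)\<close> is determined up to the torus parameter \<open>\<tau>\<close>. The value of
  \<open>\<tau>\<close> below achieves the normalisation at \<open>c\<close>.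
\<close>

definition frame_scale :: "'n pt \<Rightarrow> complex" where
  "frame_scale x = (if c \<in> S
     then wedge (snd x $ a) (snd x $ b)
       / (row_col (fst x $ c) (snd x $ b) * wedge (snd x $ c) (snd x $ b))
     else wedge (snd x $ a) (snd x $ c) / wedge (snd x $ c) (snd x $ b))"

text \<open>
  The value at \<open>q\<^sub>i\<close>, after the change of frame, of the functional \<open>v\<^sub>1 + m\<^sub>i v\<^sub>2\<close> that is
  normalised to \<open>1\<close>.
\<close>

definition affine_scale :: "'n pt \<Rightarrow> 'n \<Rightarrow> complex" where
  "affine_scale x i = wedge (snd x $ i) (snd x $ b)
     + m i * wedge (snd x $ a) (snd x $ i) / frame_scale x"

definition pos_coord :: "'n pt \<Rightarrow> 'n \<Rightarrow> complex" where
  "pos_coord x i = wedge (snd x $ a) (snd x $ i) / (frame_scale x * affine_scale x i)"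

text \<open>
  On the level set the first factor is \<open>w\<^sub>i\<close> times \<open>affine_scale x i\<close>, so this is the transformed weight
  \<open>w\<^sub>i / (e\<^sub>i\<^sup>2 det B)\<close> for \<open>e\<^sub>i = 1 / affine_scale x i\<close>. Writing it through \<open>p\<^sub>i\<close> makes sense
  at every point of the ambient space, where no \<open>w\<^sub>i\<close> need exist.
\<close>

definition mom_coord :: "'n pt \<Rightarrow> 'n \<Rightarrow> complex" where
  "mom_coord x i =
     (row_col (fst x $ i) (snd x $ b) - m i / frame_scale x * row_col (fst x $ i) (snd x $ a))
       * affine_scale x i * frame_scale x / wedge (snd x $ a) (snd x $ b)"

definition coords :: "'n pt \<Rightarrow> complex ^ ('n + 'n)" where
  "coords x = (\<chi> k. case k of
     Inl i \<Rightarrow> if i \<in> others then pos_coord x i else 0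
   | Inr i \<Rightarrow> if i \<in> others then mom_coord x i else 0)"

definition nondegenerate :: "'n pt set" where
  "nondegenerate = {x. wedge (snd x $ a) (snd x $ b) \<noteq> 0 \<and> wedge (snd x $ c) (snd x $ b) \<noteq> 0 \<and>
     (if c \<in> S then row_col (fst x $ c) (snd x $ b) \<noteq> 0 else wedge (snd x $ a) (snd x $ c) \<noteq> 0)}"

definition chart_domain :: "'n pt set" where
  "chart_domain = {x \<in> nondegenerate. \<forall>i\<in>others. affine_scale x i \<noteq> 0}"

definition free_coords :: "('n + 'n) set" where
  "free_coords = Inl ` others \<union> Inr ` others"

definition model :: "(complex ^ ('n + 'n)) set" where
  "model = {v. \<forall>k. k \<notin> free_coords \<longrightarrow> v $ k = 0}"

text \<open>
  The value that the off-diagonal moment equation forces on the product of weight and slope at \<open>c\<close>.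
\<close>

definition remainder :: "complex ^ ('n + 'n) \<Rightarrow> complex" where
  "remainder v = - (\<Sum>i\<in>others. v $ Inr i * ((1 - m i * v $ Inl i) * v $ Inl i))"

definition section_q :: "complex ^ ('n + 'n) \<Rightarrow> 'n \<Rightarrow> complex ^ 2" where
  "section_q v i = (if i = a then vector [1, 0] else if i = b then vector [0, 1]
     else if i = c then vector [1, if c \<in> S then remainder v else 1]
     else vector [1 - m i * v $ Inl i, v $ Inl i])"

definition section_w_free :: "complex ^ ('n + 'n) \<Rightarrow> 'n \<Rightarrow> complex" where
  "section_w_free v i = (if i = c then (if c \<in> S then 1 else remainder v) else v $ Inr i)"

text \<open>
  Since \<open>q\<^sub>a\<close> and \<open>q\<^sub>b\<close> are the standard basis, the weights at \<open>a\<close> and \<open>b\<close> each occur in just one of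
  the diagonal moment equations and solve it.
\<close>

definition section_w :: "complex ^ ('n + 'n) \<Rightarrow> 'n \<Rightarrow> complex" where
  "section_w v i = (if i = a then - (\<Sum>j\<in>- {a, b}. section_w_free v j * (section_q v j $ 1)\<^sup>2)
     else if i = b then - (\<Sum>j\<in>- {a, b}. section_w_free v j * (section_q v j $ 2)\<^sup>2)
     else section_w_free v i)"

definition slice_section :: "complex ^ ('n + 'n) \<Rightarrow> 'n pt" where
  "slice_section v = conormal_point (section_w v) (\<chi> i. section_q v i)"

lemma sum_split_c: "sum f (- {a, b}) = f c + sum f others" for f :: "'n \<Rightarrow> complex"
proof -
  have "- {a, b} = insert c others" "c \<notin> others" using distinct by (auto simp: others_def)
  then show ?thesis by simp
qed

lemma section_q_simps:
  "section_q v a = vector [1, 0]" "section_q v b = vector [0, 1]"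
  "section_q v c = vector [1, if c \<in> S then remainder v else 1]"
  "i \<in> others \<Longrightarrow> section_q v i = vector [1 - m i * v $ Inl i, v $ Inl i]"
  using distinct by (auto simp: section_q_def others_def)

lemma section_w_simps:
  "section_w v a = - (section_w v c + (\<Sum>i\<in>others. v $ Inr i * (1 - m i * v $ Inl i)\<^sup>2))"
  "section_w v b = - (section_w v c * (section_q v c $ 2)\<^sup>2 + (\<Sum>i\<in>others. v $ Inr i * (v $ Inl i)\<^sup>2))"
  "section_w v c = (if c \<in> S then 1 else remainder v)"
  "i \<in> others \<Longrightarrow> section_w v i = v $ Inr i"
proof -
  have o: "i \<in> others \<Longrightarrow> i \<noteq> c" for i by (auto simp: others_def)
  show "section_w v a = - (section_w v c + (\<Sum>i\<in>others. v $ Inr i * (1 - m i * v $ Inl i)\<^sup>2))"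
    "section_w v b = - (section_w v c * (section_q v c $ 2)\<^sup>2 + (\<Sum>i\<in>others. v $ Inr i * (v $ Inl i)\<^sup>2))"
    using distinct
    by (auto simp: section_w_def sum_split_c section_q_simps section_w_free_def o intro!: sum.cong)
  show "section_w v c = (if c \<in> S then 1 else remainder v)"
    "i \<in> others \<Longrightarrow> section_w v i = v $ Inr i"
    using distinct by (auto simp: section_w_def section_w_free_def others_def)
qed

lemma moment_map_slice_section: "moment_map (slice_section v) = 0"
proof -
  have "(\<Sum>i\<in>others. section_w v i * (section_q v i $ 1 * section_q v i $ 2)) = - remainder v"
    "(\<Sum>i\<in>others. section_w v i * (section_q v i $ 1)\<^sup>2) =
      (\<Sum>i\<in>others. v $ Inr i * (1 - m i * v $ Inl i)\<^sup>2)"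
    "(\<Sum>i\<in>others. section_w v i * (section_q v i $ 2)\<^sup>2) = (\<Sum>i\<in>others. v $ Inr i * (v $ Inl i)\<^sup>2)"
    by (simp_all add: remainder_def section_w_simps section_q_simps)
  then show ?thesis
    unfolding slice_section_def moment_map_conormal_point
    by (simp add: sum_split section_q_simps section_w_simps)
qed

lemma wedge_vector: "wedge (vector [r, s]) (vector [t, u]) = r * u - s * t"
  by (simp add: wedge_def)

lemma frame_scale_section: "frame_scale (slice_section v) = 1"
  by (simp add: frame_scale_def slice_section_def section_q_simps section_w_simps row_col_perp
      wedge_vector)

lemma affine_scale_section: "i \<in> others \<Longrightarrow> affine_scale (slice_section v) i = 1"
  unfolding affine_scale_def frame_scale_section
  by (simp add: slice_section_def section_q_simps wedge_vector)

lemma slice_section_domain: "slice_section v \<in> chart_domain"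
  unfolding chart_domain_def nondegenerate_def
  by (simp add: affine_scale_section)
    (simp add: slice_section_def section_q_simps section_w_simps wedge_vector row_col_perp)

lemma coords_slice_section:
  assumes "v \<in> model"
  shows "coords (slice_section v) = v"
proof -
  have "pos_coord (slice_section v) i = v $ Inl i" "mom_coord (slice_section v) i = v $ Inr i"
    if "i \<in> others" for i
    unfolding pos_coord_def mom_coord_def frame_scale_section affine_scale_section[OF that]
    by (simp_all add: slice_section_def section_q_simps section_w_simps wedge_vector row_col_perp that
        algebra_simps)
  moreover have "v $ Inl i = 0" "v $ Inr i = 0" if "i \<notin> others" for i
    using assms that by (auto simp: model_def free_coords_def image_iff)
  ultimately show ?thesis
    by (simp add: coords_def vec_eq_iff split: sum.split)
qed

lemma coords_in_model: "coords x \<in> model"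
  by (auto simp: coords_def model_def free_coords_def split: sum.split)

lemma nondegenerate_scale: "x \<in> nondegenerate \<Longrightarrow> frame_scale x \<noteq> 0"
  by (auto simp: nondegenerate_def frame_scale_def split: if_splits)

text \<open>
  The weights of all factors under the scalars \<open>e\<close> cancel: \<open>frame_scale\<close> has weight \<open>e\<^sub>a / e\<^sub>b\<close> and
  \<open>affine_scale\<close> has weight \<open>e\<^sub>i e\<^sub>b\<close>.
\<close>

lemma coords_orbit:
  assumes eq: "orbit x = orbit y" and x: "x \<in> chart_domain"
  shows "y \<in> chart_domain" "coords x = coords y"
proof -
  from eq obtain e where e: "\<And>i. e i \<noteq> 0"
    and w: "\<And>i j. wedge (snd y $ i) (snd y $ j) = e i * e j * wedge (snd x $ i) (snd x $ j)"
    and r: "\<And>i j. row_col (fst y $ i) (snd y $ j) = e j / e i * row_col (fst x $ i) (snd x $ j)"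
    by (rule orbit_eqE) blast
  have \<tau>: "frame_scale y = e a / e b * frame_scale x"
    using e by (simp add: frame_scale_def w r)
  have x': "x \<in> nondegenerate" using x by (simp add: chart_domain_def)
  have y': "y \<in> nondegenerate" using x' e by (simp add: nondegenerate_def w r split: if_splits)
  have \<tau>0: "frame_scale x \<noteq> 0" using nondegenerate_scale[OF x'] .
  have \<nu>: "affine_scale y i = e i * e b * affine_scale x i" for i
    using e \<tau>0 by (simp add: affine_scale_def \<tau> w field_simps)
  show "y \<in> chart_domain" using x y' e by (simp add: chart_domain_def \<nu>)
  have "pos_coord y i = pos_coord x i" for i
    using e \<tau>0 by (simp add: pos_coord_def \<tau> \<nu> w field_simps)
  moreover have "mom_coord y i = mom_coord x i" for i
  proof -
    have "row_col (fst y $ i) (snd y $ b) - m i / frame_scale y * row_col (fst y $ i) (snd y $ a)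
      = e b / e i * (row_col (fst x $ i) (snd x $ b) - m i / frame_scale x * row_col (fst x $ i) (snd x $ a))"
      using e \<tau>0 by (simp add: \<tau> r field_simps)
    then show ?thesis using e \<tau>0 by (simp add: mom_coord_def \<tau> \<nu> w)
  qed
  ultimately show "coords x = coords y" by (simp add: coords_def vec_eq_iff split: sum.split)
qed

lemma cdiff_frame_scale: "x \<in> nondegenerate \<Longrightarrow> cdiff pt_scale UNIV x frame_scale"
  unfolding frame_scale_def nondegenerate_def
  by (cases "c \<in> S") (auto intro!: cdiff_divide cdiff_mult)

lemma cdiff_affine_scale: "x \<in> nondegenerate \<Longrightarrow> cdiff pt_scale UNIV x (\<lambda>x. affine_scale x i)"
  unfolding affine_scale_def
  by (intro cdiff_add cdiff_divide cdiff_mult cdiff_wedge cdiff_const cdiff_frame_scale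
      nondegenerate_scale)

lemma cdiff_coords:
  assumes x: "x \<in> chart_domain"
  shows "cdiff pt_scale UNIV x (\<lambda>y. coords y $ k)"
proof -
  have n: "x \<in> nondegenerate" using x by (simp add: chart_domain_def)
  have d: "wedge (snd x $ a) (snd x $ b) \<noteq> 0" using n by (simp add: nondegenerate_def)
  have "cdiff pt_scale UNIV x (\<lambda>x. pos_coord x i)" "cdiff pt_scale UNIV x (\<lambda>x. mom_coord x i)"
    if "i \<in> others" for i
  proof -
    have "affine_scale x i \<noteq> 0" using x that by (simp add: chart_domain_def)
    then show "cdiff pt_scale UNIV x (\<lambda>x. pos_coord x i)"
      unfolding pos_coord_def using nondegenerate_scale[OF n]
      by (intro cdiff_divide cdiff_mult cdiff_wedge cdiff_frame_scale cdiff_affine_scale n) simp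
    show "cdiff pt_scale UNIV x (\<lambda>x. mom_coord x i)"
      unfolding mom_coord_def
      by (intro cdiff_divide cdiff_mult cdiff_diff cdiff_const cdiff_row_col cdiff_wedge
          cdiff_frame_scale cdiff_affine_scale n d nondegenerate_scale)
  qed
  then have "cdiff pt_scale UNIV x (\<lambda>y. if i \<in> others then pos_coord y i else 0)"
    "cdiff pt_scale UNIV x (\<lambda>y. if i \<in> others then mom_coord y i else 0)" for i
    by (cases "i \<in> others"; simp add: cdiff_const)+
  then show ?thesis by (cases k) (simp_all add: coords_def)
qed

lemma open_chart_domain: "open chart_domain"
proof -
  have n: "open nondegenerate"
    unfolding nondegenerate_def
    by (cases "c \<in> S") (auto intro!: open_Collect_conj open_Collect_neq continuous_intros)
  have "open (nondegenerate \<inter> (\<lambda>x. affine_scale x i) -` (- {0}))" for i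
    by (rule continuous_open_preimage[OF _ n])
      (auto simp: continuous_on_eq_continuous_within
        intro!: continuous_at_imp_continuous_at_within
          cdiff_continuous[where sc = pt_scale and E = UNIV] cdiff_affine_scale)
  then have "open (nondegenerate \<inter> (\<Inter>i\<in>others. nondegenerate \<inter> (\<lambda>x. affine_scale x i) -` (- {0})))"
    by (intro open_Int n open_INT) auto
  also have "\<dots> = chart_domain" by (auto simp: chart_domain_def)
  finally show ?thesis .
qed

lemma cdiff_slice_section:
  "cdiff (*s) E v (\<lambda>y. fst (slice_section y) $ i $ k)"
  "cdiff (*s) E v (\<lambda>y. snd (slice_section y) $ i $ k)"
proof -
  have rem: "cdiff (*s) E v remainder"
    unfolding remainder_def by (intro cdiff_minus cdiff_sum cdiff_mult cdiff_diff cdiff_const cdiff_vec_nth)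
  have q: "cdiff (*s) E v (\<lambda>y. section_q y j $ l)" for j l
  proof -
    have "j = a \<or> j = b \<or> j = c \<or> j \<in> others" by (auto simp: others_def)
    then show ?thesis using exhaust_2[of l] rem
      by (elim disjE; cases "c \<in> S")
        (simp_all add: section_q_simps cdiff_mult cdiff_diff cdiff_const cdiff_vec_nth)
  qed
  have wf: "cdiff (*s) E v (\<lambda>y. section_w_free y j)" for j
    using rem by (cases "j = c"; cases "c \<in> S")
      (simp_all add: section_w_free_def cdiff_const cdiff_vec_nth)
  have w: "cdiff (*s) E v (\<lambda>y. section_w y j)" for j
    unfolding section_w_def using distinct(1)
    by (cases "j = a"; cases "j = b")
      (simp_all add: cdiff_minus cdiff_sum cdiff_mult cdiff_power q wf)
  show "cdiff (*s) E v (\<lambda>y. snd (slice_section y) $ i $ k)"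
    by (simp add: slice_section_def q)
  show "cdiff (*s) E v (\<lambda>y. fst (slice_section y) $ i $ k)"
    using exhaust_2[of k] by (auto simp: slice_section_def perp_def intro!: cdiff_mult cdiff_minus w q)
qed

text \<open>
  The matrix \<open>B\<close> and the scalars \<open>e\<close> bring \<open>x\<close> to a point of the same orbit with normalised vectors and
  weights \<open>(w', q')\<close>. For the free indices these are the coordinates by definition; for \<open>a, b, c\<close> they
  agree with the section because \<open>(w', q')\<close> satisfies the moment equations, which
  determine what the normalisation leaves open.
\<close>

lemma orbit_slice_section_coords:
  assumes x: "x \<in> chart_domain" "x \<in> level_set \<alpha>"
  shows "orbit (slice_section (coords x)) = orbit x"
proof -
  obtain w where w: "x = conormal_point w (snd x)" using x(2) by (rule level_set_conormal)
  define q where "q = snd x"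
  have xw: "x = conormal_point w q" using w by (simp add: q_def)
  have pw: "row_col (fst x $ i) u = w i * wedge (q $ i) u" for i u
    by (subst xw) (simp add: row_col_perp)
  define \<delta> where "\<delta> = wedge (q $ a) (q $ b)"
  define \<tau> where "\<tau> = frame_scale x"
  have n: "x \<in> nondegenerate" using x by (simp add: chart_domain_def)
  have \<tau>: "\<tau> \<noteq> 0" using nondegenerate_scale[OF n] by (simp add: \<tau>_def)
  have \<delta>: "\<delta> \<noteq> 0" and \<alpha>c: "wedge (q $ c) (q $ b) \<noteq> 0"
    using n by (auto simp: nondegenerate_def \<delta>_def q_def)
  have \<nu>: "affine_scale x i = wedge (q $ i) (q $ b) + m i * wedge (q $ a) (q $ i) / \<tau>" for i
    by (simp add: affine_scale_def q_def \<tau>_def)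
  have \<nu>0: "affine_scale x i \<noteq> 0" if "i \<in> others" for i using x(1) that by (simp add: chart_domain_def)
  define B :: "(complex ^ 2) ^ 2" where
    "B = vector [vector [q $ b $ 2, - (q $ b $ 1)], vector [- (q $ a $ 2) / \<tau>, q $ a $ 1 / \<tau>]]"
  have Bv: "B *v u = vector [wedge u (q $ b), wedge (q $ a) u / \<tau>]" for u
    using \<tau> by (simp add: B_def vec2_eq_iff matrix_vector_mult_def sum_2 wedge_def field_simps)
  have detB: "det B = \<delta> / \<tau>"
    using \<tau> by (simp add: B_def det_2 \<delta>_def wedge_def field_simps)
  define e where "e = (\<lambda>i. if i = a then 1 / \<delta> else if i = b then \<tau> / \<delta> else
      if i = c then 1 / wedge (q $ c) (q $ b) else 1 / affine_scale x i)"
  have e0: "e i \<noteq> 0" for i using \<delta> \<tau> \<alpha>c \<nu>0[of i] by (auto simp: e_def others_def)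
  have es: "e a = 1 / \<delta>" "e b = \<tau> / \<delta>" "e c = 1 / wedge (q $ c) (q $ b)"
    "i \<in> others \<Longrightarrow> e i = 1 / affine_scale x i" for i
    using distinct by (auto simp: e_def others_def)
  define q' where "q' = (\<chi> i. e i *s (B *v q $ i))"
  define w' where "w' = (\<lambda>i. w i / ((e i)\<^sup>2 * det B))"
  have ww': "w i = w' i * (e i)\<^sup>2 * det B" for i
    using e0[of i] \<delta> \<tau> by (simp add: w'_def detB)
  have orb: "orbit (conormal_point w' q') = orbit (conormal_point w q)"
    by (rule orbit_conormal_point[of B e]) (use \<delta> \<tau> e0 ww' in \<open>auto simp: detB q'_def\<close>)
  define v where "v = coords x"
  have v: "v $ Inl i = pos_coord x i" "v $ Inr i = mom_coord x i" if "i \<in> others" for i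
    using that by (auto simp: v_def coords_def)
  have q'a: "q' $ a = vector [1, 0]"
    using \<delta> by (simp add: q'_def Bv es vec2_eq_iff flip: \<delta>_def)
  have q'b: "q' $ b = vector [0, 1]"
    using \<delta> \<tau> by (simp add: q'_def Bv es vec2_eq_iff flip: \<delta>_def)
  have q'o: "q' $ i = section_q v i" if "i \<in> others" for i
  proof -
    have "1 - m i * pos_coord x i = wedge (q $ i) (q $ b) / affine_scale x i"
      using \<nu>0[OF that] \<tau> unfolding pos_coord_def
      by (simp add: field_simps flip: \<tau>_def q_def) (simp add: \<nu> field_simps \<tau>)
    then show ?thesis using that \<tau> \<nu>0[OF that]
      by (simp add: q'_def Bv es section_q_simps v vec2_eq_iff) (simp add: pos_coord_def q_def \<tau>_def)
  qed
  have w'o: "w' i = section_w v i" if "i \<in> others" for i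
  proof -
    have "row_col (fst x $ i) (snd x $ b) - m i / \<tau> * row_col (fst x $ i) (snd x $ a)
        = w i * affine_scale x i"
      by (simp add: pw \<nu> wedge_swap[of "q $ i" "q $ a"] algebra_simps flip: q_def)
    then have "mom_coord x i = w i * (affine_scale x i)\<^sup>2 * \<tau> / \<delta>"
      unfolding mom_coord_def \<tau>_def[symmetric] q_def[symmetric] \<delta>_def[symmetric]
      by (simp add: power2_eq_square q_def)
    then show ?thesis using \<nu>0[OF that] \<tau> \<delta>
      by (simp add: section_w_simps that v w'_def es detB field_simps power2_eq_square)
  qed
  define z where "z = wedge (q $ a) (q $ c) / (\<tau> * wedge (q $ c) (q $ b))"
  have q'c: "q' $ c = vector [1, z]"
    using \<alpha>c \<tau> by (simp add: q'_def Bv es z_def vec2_eq_iff)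
  have mom0: "moment_map (conormal_point w q) = 0" using x(2) xw by (simp add: level_set_def)
  have mom: "(\<Sum>i\<in>UNIV. w' i * (q' $ i $ 1)\<^sup>2) = 0" "(\<Sum>i\<in>UNIV. w' i * (q' $ i $ 1 * q' $ i $ 2)) = 0"
    "(\<Sum>i\<in>UNIV. w' i * (q' $ i $ 2)\<^sup>2) = 0"
  proof -
    have tr: "w' i * (q' $ i $ k * q' $ i $ l) = w i * ((B *v q $ i) $ k * (B *v q $ i) $ l) / det B" for i k l
      using e0[of i] by (simp add: w'_def q'_def power2_eq_square)
    define Q where "Q = (\<lambda>k l. \<Sum>i\<in>UNIV. w i * (q $ i $ k * q $ i $ l))"
    have Q: "Q 1 1 = 0" "Q 1 2 = 0" "Q 2 1 = 0" "Q 2 2 = 0"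
      using mom0 by (simp_all add: Q_def moment_map_conormal_point power2_eq_square mult.commute)
    have "(\<Sum>i\<in>UNIV. w' i * (q' $ i $ k * q' $ i $ l)) = 0" for k l
    proof -
      have "(\<Sum>i\<in>UNIV. w i * ((B *v q $ i) $ k * (B *v q $ i) $ l))
          = B $ k $ 1 * B $ l $ 1 * Q 1 1 + B $ k $ 1 * B $ l $ 2 * Q 1 2
            + B $ k $ 2 * B $ l $ 1 * Q 2 1 + B $ k $ 2 * B $ l $ 2 * Q 2 2"
        unfolding Q_def sum_distrib_left sum.distrib[symmetric]
        by (rule sum.cong) (simp_all add: matrix_vector_mult_def sum_2 algebra_simps)
      then show ?thesis unfolding tr Q sum_divide_distrib[symmetric] by simp
    qed
    then show "(\<Sum>i\<in>UNIV. w' i * (q' $ i $ 1)\<^sup>2) = 0" "(\<Sum>i\<in>UNIV. w' i * (q' $ i $ 1 * q' $ i $ 2)) = 0"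
      "(\<Sum>i\<in>UNIV. w' i * (q' $ i $ 2)\<^sup>2) = 0"
      by (simp_all add: power2_eq_square)
  qed
  have so: "(\<Sum>i\<in>others. w' i * (q' $ i $ k * q' $ i $ l)) =
      (\<Sum>i\<in>others. section_w v i * (section_q v i $ k * section_q v i $ l))" for k l
    using q'o w'o by simp
  \<comment> \<open>The off-diagonal moment equation; the terms at \<open>a\<close> and \<open>b\<close> vanish in the normalised frame.\<close>
  have wz: "w' c * z = remainder v"
    using mom(2) so[of 1 2]
    by (simp add: sum_split q'a q'b q'c remainder_def section_w_simps section_q_simps
        eq_neg_iff_add_eq_0)
  have c: "q' $ c = section_q v c \<and> w' c = section_w v c"
  proof (cases "c \<in> S")
    case True
    have "w' c = w c * (wedge (q $ c) (q $ b))\<^sup>2 * \<tau> / \<delta>"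
      using \<alpha>c \<tau> \<delta> by (simp add: w'_def es detB field_simps power2_eq_square)
    also have "\<tau> = \<delta> / (w c * wedge (q $ c) (q $ b) * wedge (q $ c) (q $ b))"
      using True by (simp add: \<tau>_def frame_scale_def pw \<delta>_def flip: q_def)
    finally have "w' c = 1" using \<delta> \<tau> \<alpha>c n True
      by (simp add: nondegenerate_def pw power2_eq_square flip: q_def)
    then show ?thesis using wz True by (simp add: q'c section_q_simps section_w_simps)
  next
    case False
    then have "z = 1" using \<alpha>c n by (simp add: z_def \<tau>_def frame_scale_def nondegenerate_def q_def)
    then show ?thesis using wz False by (simp add: q'c section_q_simps section_w_simps)
  qed
  have "w' a + (section_w v c + (\<Sum>i\<in>others. v $ Inr i * (1 - m i * v $ Inl i)\<^sup>2)) = 0"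
    using mom(1) so[of 1 1] c
    by (simp add: sum_split q'a q'b section_q_simps section_w_simps power2_eq_square add_ac)
  then have "w' a = section_w v a"
    unfolding section_w_simps(1) eq_neg_iff_add_eq_0 .
  moreover have "w' b + (section_w v c * (section_q v c $ 2)\<^sup>2
      + (\<Sum>i\<in>others. v $ Inr i * (v $ Inl i)\<^sup>2)) = 0"
    using mom(3) so[of 2 2] c
    by (simp add: sum_split q'a q'b section_q_simps section_w_simps power2_eq_square add_ac)
  then have "w' b = section_w v b"
    unfolding section_w_simps(2) eq_neg_iff_add_eq_0 .
  moreover have cases: "i = a \<or> i = b \<or> i = c \<or> i \<in> others" for i by (auto simp: others_def)
  ultimately have "w' = section_w v" using w'o c by (intro ext) metis
  moreover have "q' $ i = section_q v i" for i
    using cases[of i] q'a q'b q'o c by (auto simp: section_q_simps)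
  then have "q' = (\<chi> i. section_q v i)" by (simp add: vec_eq_iff)
  ultimately have "conormal_point w' q' = slice_section v"
    by (simp add: slice_section_def)
  then show ?thesis using orb xw by (simp add: v_def)
qed

text \<open>
  The coordinates that remain free on the core component: slopes off \<open>S\<close> and weights on \<open>S\<close>.
\<close>

definition core_coords :: "('n + 'n) set" where
  "core_coords = Inl ` (others - S) \<union> Inr ` (others \<inter> S)"

text \<open>
  For each free index the slope or the weight vanishes, so all sums that determine the
  remaining entries vanish too. Hence \<open>w\<^sub>b = 0\<close>, and the entry at \<open>c\<close> that is not
  normalised is zero: the slope if \<open>c \<in> S\<close> and the weight otherwise, as required in each case.
\<close>

lemma in_core_slice_section:
  assumes v: "\<And>k. k \<notin> core_coords \<Longrightarrow> v $ k = 0"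
  shows "in_core S (slice_section v)"
proof -
  have z: "v $ Inl i = 0" if "i \<in> S" for i using that by (intro v) (auto simp: core_coords_def)
  have w: "v $ Inr i = 0" if "i \<notin> S" for i using that by (intro v) (auto simp: core_coords_def)
  have zw: "v $ Inr i * (r * v $ Inl i) = 0" for i r using z[of i] w[of i] by auto
  have rem: "remainder v = 0" by (simp add: remainder_def zw)
  have sq: "(\<Sum>i\<in>others. v $ Inr i * (v $ Inl i)\<^sup>2) = 0" by (simp add: power2_eq_square zw)
  have "section_q v i = vector [1, 0]" if "i \<in> S" for i
    using that a_in b_notin z[of i] rem by (auto simp: section_q_def)
  moreover have "section_w v j = 0" if "j \<notin> S" for j
  proof -
    have "j = b \<or> j = c \<or> j \<in> others" using that a_in b_notin by (auto simp: others_def)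
    then show ?thesis using that a_in b_notin w[of j] rem sq
      by (auto simp: section_w_simps section_q_simps)
  qed
  ultimately show ?thesis by (simp add: in_core_def slice_section_def)
qed

lemma in_core_iff_coords:
  assumes x: "x \<in> chart_domain" "x \<in> level_set \<alpha>"
  shows "in_core S x \<longleftrightarrow> (\<forall>k. k \<notin> core_coords \<longrightarrow> coords x $ k = 0)"
proof
  assume core: "in_core S x"
  show "\<forall>k. k \<notin> core_coords \<longrightarrow> coords x $ k = 0"
  proof (intro allI impI)
    fix k assume "k \<notin> core_coords"
    then show "coords x $ k = 0" using core a_in b_notin
      by (cases k)
        (auto simp: coords_def core_coords_def in_core_def pos_coord_def mom_coord_def image_iff)
  qed
next
  assume "\<forall>k. k \<notin> core_coords \<longrightarrow> coords x $ k = 0"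
  then have "in_core S (slice_section (coords x))" by (intro in_core_slice_section) auto
  then show "in_core S x" using in_core_orbit[OF orbit_slice_section_coords[OF x]] by simp
qed

text \<open>
  Free slopes and weights come in pairs, and for each index exactly one member of the pair survives on
  the core component. This is why it has half the dimension of the quotient.
\<close>

lemma exists_adapted_chart:
  assumes x: "x \<in> chart_domain" "x \<in> level_set \<alpha>"
    and U: "\<And>y. y \<in> level_set \<alpha> \<Longrightarrow> orbit y \<in> U \<longleftrightarrow> in_core S y"
  shows "\<exists>W E \<phi> F. orbit x \<in> W \<and> holomorphic_chart \<alpha> W E \<phi> \<and>
        F \<subseteq> E \<and> vec.subspace F \<and> vec.dim F = CARD('n) - 3 \<and> \<phi> ` (W \<inter> U) = \<phi> ` W \<inter> F"
proof -
  have "card free_coords = card others + card others"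
    unfolding free_coords_def by (subst card_Un_disjoint) (auto simp: card_image)
  then have card: "card free_coords = 2 * (CARD('n) - 3)" by (simp add: card_others)
  have "\<exists>\<phi>. holomorphic_chart \<alpha> (orbit ` (chart_domain \<inter> level_set \<alpha>)) model \<phi> \<and>
    (\<forall>x\<in>chart_domain. \<phi> (orbit x) = coords x)"
  proof (rule holomorphic_chart_of_slice[OF model_def card open_chart_domain])
    show "y \<in> chart_domain" "coords x = coords y" if "x \<in> chart_domain" "orbit x = orbit y" for x y
      using coords_orbit[OF that(2,1)] .
    show "coords x \<in> model" for x by (rule coords_in_model)
    show "cdiff pt_scale UNIV x (\<lambda>y. coords y $ k)" if "x \<in> chart_domain" for x k
      using that by (rule cdiff_coords)
    show "orbit (slice_section (coords x)) = orbit x" if "x \<in> chart_domain" "x \<in> level_set \<alpha>" for x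
      using that by (rule orbit_slice_section_coords)
    show "coords (slice_section v) = v" if "v \<in> model" for v using that by (rule coords_slice_section)
  qed (rule cdiff_slice_section moment_map_slice_section slice_section_domain)+
  then obtain \<phi> where \<phi>: "holomorphic_chart \<alpha> (orbit ` (chart_domain \<inter> level_set \<alpha>)) model \<phi>"
    "\<And>x. x \<in> chart_domain \<Longrightarrow> \<phi> (orbit x) = coords x"
    by blast
  define F where "F = {v :: complex ^ ('n + 'n). \<forall>k. k \<notin> core_coords \<longrightarrow> v $ k = 0}"
  have "card core_coords = card (others - S) + card (others \<inter> S)"
    unfolding core_coords_def by (subst card_Un_disjoint) (auto simp: card_image)
  also have "\<dots> = card others"
    by (subst card_Un_disjoint[symmetric]) (auto intro: arg_cong[of _ _ card])
  finally have "vec.dim F = CARD('n) - 3"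
    unfolding F_def dim_substandard_cart by (simp add: card_others)
  moreover have "vec.subspace F" unfolding F_def vec.subspace_def by auto
  moreover have "F \<subseteq> model"
    by (auto simp: F_def model_def free_coords_def core_coords_def)
  moreover have "\<phi> ` (orbit ` (chart_domain \<inter> level_set \<alpha>) \<inter> U)
      = \<phi> ` (orbit ` (chart_domain \<inter> level_set \<alpha>)) \<inter> F"
  proof -
    have "coords y \<in> F \<longleftrightarrow> orbit y \<in> U" if "y \<in> chart_domain" "y \<in> level_set \<alpha>" for y
      using in_core_iff_coords[OF that] U[OF that(2)] by (simp add: F_def)
    then show ?thesis using \<phi>(2) by auto
  qed
  moreover have "orbit x \<in> orbit ` (chart_domain \<inter> level_set \<alpha>)" using x by simp
  ultimately show ?thesis using \<phi>(1) by (intro exI conjI)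
qed

end

section \<open>The core component as a subset of the quotient\<close>

definition core_set :: "('n::finite \<Rightarrow> real) \<Rightarrow> 'n set \<Rightarrow> 'n pt set set" where
  "core_set \<alpha> S = orbit ` {x \<in> level_set \<alpha>. in_core S x}"

lemma level_set_q: "x \<in> level_set \<alpha> \<Longrightarrow> snd x $ i \<noteq> 0"
  by (auto simp: level_set_def stable_iff_wedge)

lemma level_set_short:
  assumes "x \<in> level_set \<alpha>" "\<And>i j. \<lbrakk>i \<in> T; j \<in> T\<rbrakk> \<Longrightarrow> wedge (snd x $ i) (snd x $ j) = 0"
    "\<And>j. j \<notin> T \<Longrightarrow> fst x $ j = 0"
  shows "short \<alpha> T"
  using assms by (auto simp: level_set_def stable_iff_wedge)

lemma core_set_alt:
  "core_set \<alpha> S =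
     {orbit (p, q) | p q. (p, q) \<in> level_set \<alpha> \<and> straight q S \<and> (\<forall>j\<in>- S. p $ j = 0)}"
proof -
  have "in_core S (p, q) \<longleftrightarrow> straight q S \<and> (\<forall>j\<in>- S. p $ j = 0)" if "(p, q) \<in> level_set \<alpha>" for p q
    using level_set_q[OF that] by (simp add: in_core_def straight_iff_wedge)
  then show ?thesis unfolding core_set_def by (auto simp: image_iff) blast+
qed

lemma orbit_in_core_set_iff:
  assumes "x \<in> level_set \<alpha>"
  shows "orbit x \<in> core_set \<alpha> S \<longleftrightarrow> in_core S x"
proof
  assume "orbit x \<in> core_set \<alpha> S"
  then obtain y where "in_core S y" "orbit x = orbit y" by (auto simp: core_set_def)
  then show "in_core S x" using in_core_orbit by blast
qed (use assms in \<open>simp add: core_set_def\<close>)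

lemma closedin_core_set: "closedin (hyperpolygon_top \<alpha>) (core_set \<alpha> S)"
proof -
  let ?C = "{x. in_core S x}"
  have "closed ?C" unfolding in_core_def Ball_def
    by (intro closed_Collect_conj closed_Collect_all closed_Collect_imp open_Collect_const
        closed_Collect_eq continuous_intros)
  then have "open (- ?C)" by (rule open_Compl)
  moreover have "{x \<in> level_set \<alpha>. orbit x \<in> hyperpolygon_space \<alpha> - core_set \<alpha> S} = level_set \<alpha> \<inter> - ?C"
    by (auto simp: orbit_in_core_set_iff hyperpolygon_space_def)
  moreover have "core_set \<alpha> S \<subseteq> hyperpolygon_space \<alpha>"
    by (auto simp: core_set_def hyperpolygon_space_def)
  ultimately show ?thesis
    by (auto simp: closedin_def topspace_hyperpolygon_top openin_hyperpolygon_top openin_open)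
qed

lemma open_path_preimage:
  assumes \<gamma>: "continuous_on UNIV \<gamma>" "\<And>t. \<gamma> t \<in> level_set \<alpha>"
    and T: "openin (hyperpolygon_top \<alpha>) T"
  shows "open {t. orbit (\<gamma> t) \<in> T}"
proof -
  obtain M where M: "open M" "{x \<in> level_set \<alpha>. orbit x \<in> T} = level_set \<alpha> \<inter> M"
    using T by (auto simp: openin_hyperpolygon_top openin_open)
  have "orbit (\<gamma> t) \<in> T \<longleftrightarrow> \<gamma> t \<in> M" for t
  proof -
    have "\<gamma> t \<in> {x \<in> level_set \<alpha>. orbit x \<in> T} \<longleftrightarrow> \<gamma> t \<in> level_set \<alpha> \<inter> M" by (simp only: M(2))
    then show ?thesis using \<gamma>(2) by simp
  qed
  then have "{t. orbit (\<gamma> t) \<in> T} = \<gamma> -` M" by (simp add: vimage_def)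
  then show ?thesis using open_vimage[OF M(1) \<gamma>(1)] by simp
qed

lemma continuous_on_conormal_point [continuous_intros]:
  assumes "\<And>i. continuous_on A (\<lambda>t. w t i)" "continuous_on A q"
  shows "continuous_on A (\<lambda>t. conormal_point (w t) (q t))"
proof -
  have "continuous_on A (\<lambda>t. (w t i *s perp (q t $ i)) $ k)" for i k
    using exhaust_2[of k]
    by (elim disjE; simp add: perp_def; intro continuous_intros assms)
  then have "continuous_on A (\<lambda>t. \<chi> i. \<chi> k. (w t i *s perp (q t $ i)) $ k)"
    by (intro continuous_on_vec_lambda)
  then have "continuous_on A (\<lambda>t. \<chi> i. w t i *s perp (q t $ i))"
    by (simp only: vec_lambda_eta)
  then show ?thesis using assms(2) unfolding conormal_point_def by (rule continuous_on_Pair)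
qed

lemma short_not_Compl: "short \<alpha> S \<Longrightarrow> \<not> short \<alpha> (- S)"
  by (simp add: short_def)

lemma short_subset:
  assumes "\<And>i. \<alpha> i > 0" "short \<alpha> S" "T \<subseteq> S"
  shows "short \<alpha> T"
proof -
  have "sum \<alpha> T \<le> sum \<alpha> S" "sum \<alpha> (- S) \<le> sum \<alpha> (- T)"
    using assms by (auto intro!: sum_mono2 less_imp_le[OF assms(1)])
  then show ?thesis using assms(2) by (simp add: short_def)
qed

lemma not_short_UNIV:
  assumes "\<And>i. \<alpha> i > 0"
  shows "\<not> short \<alpha> UNIV"
  using sum_nonneg[of UNIV \<alpha>] assms by (simp add: short_def not_less less_imp_le)

text \<open>
  If \<open>p\<^sub>c \<noteq> 0\<close> and no vector outside \<open>S\<close> is parallel to \<open>q\<^sub>c\<close>, then a straight set outside which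
  \<open>p\<close> vanishes contains \<open>c\<close> and hence is contained in \<open>S\<close>. So stability is automatic at such points,
  and they can be deformed freely as long as the moment equations hold.
\<close>

lemma stable_of_transverse:
  assumes "\<And>i. \<alpha> i > 0" "short \<alpha> S" "\<And>i. snd x $ i \<noteq> 0"
    and "c \<in> S" "fst x $ c \<noteq> 0" "\<And>j. j \<notin> S \<Longrightarrow> wedge (snd x $ c) (snd x $ j) \<noteq> 0"
  shows "stable \<alpha> x"
  unfolding stable_iff_wedge
proof (intro conjI allI impI; (elim conjE)?)
  fix T assume T: "\<forall>i\<in>T. \<forall>j\<in>T. wedge (snd x $ i) (snd x $ j) = 0" "\<forall>j\<in>- T. fst x $ j = 0"
  then have "c \<in> T" using assms(5) by blast
  then have "T \<subseteq> S" using T(1) assms(6) by blast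
  then show "short \<alpha> T" using short_subset assms(1,2) by blast
qed (use assms in auto)

text \<open>
  Otherwise the whole index set would be straight, hence short, which is absurd for positive \<open>\<alpha>\<close>.
\<close>

lemma exists_transverse:
  assumes pos: "\<And>i. \<alpha> i > 0" and x: "x \<in> level_set \<alpha>"
  shows "\<exists>b. wedge (snd x $ a) (snd x $ b) \<noteq> 0"
proof (rule ccontr)
  assume "\<not> ?thesis"
  then have *: "wedge (snd x $ i) (snd x $ a) = 0" "wedge (snd x $ a) (snd x $ i) = 0" for i
    using wedge_swap[of "snd x $ i"] by auto
  have "short \<alpha> UNIV"
    using x wedge_eq_0_trans[OF * level_set_q[OF x]] by (rule level_set_short) simp
  then show False using not_short_UNIV[of \<alpha>] pos by blast
qed

text \<open>
  It remains to find a slice through the given point. If some \<open>p\<^sub>c \<noteq> 0\<close> then \<open>c \<in> S\<close>, and \<open>a\<close>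
  is a second element of \<open>S\<close>. If \<open>p = 0\<close>, the vectors parallel to \<open>q\<^sub>a\<close> and those parallel to \<open>q\<^sub>b\<close>
  cannot exhaust all indices, since these two complementary straight sets would both be short; so there
  is a third line.
\<close>

lemma exists_smooth_chart:
  fixes \<alpha> :: "'n::finite \<Rightarrow> real"
  assumes pos: "\<And>i. \<alpha> i > 0" and S: "card S \<ge> 2"
    and x: "x \<in> level_set \<alpha>" "in_core S x"
  shows "\<exists>W E \<phi> F. orbit x \<in> W \<and> holomorphic_chart \<alpha> W E \<phi> \<and>
        F \<subseteq> E \<and> vec.subspace F \<and> vec.dim F = CARD('n) - 3 \<and>
        \<phi> ` (W \<inter> core_set \<alpha> S) = \<phi> ` W \<inter> F"
proof -
  note q0 = level_set_q[OF x(1)]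
  obtain w where w: "x = conormal_point w (snd x)" using x(1) by (rule level_set_conormal)
  have Sq: "wedge (snd x $ i) (snd x $ j) = 0" if "i \<in> S" "j \<in> S" for i j
    using that x(2) by (auto simp: in_core_def)
  have "\<exists>a b c. a \<in> S \<and> b \<notin> S \<and> a \<noteq> c \<and> b \<noteq> c \<and>
     x \<in> frame_slice.nondegenerate S a b c"
  proof (cases "\<exists>c\<in>S. fst x $ c \<noteq> 0")
    case True
    then obtain c where c: "c \<in> S" "fst x $ c \<noteq> 0" by blast
    have "\<not> S \<subseteq> {c}" using S card_mono[of "{c}" S] by auto
    then obtain a where a: "a \<in> S" "a \<noteq> c" by auto
    obtain b where b: "wedge (snd x $ a) (snd x $ b) \<noteq> 0" using exists_transverse[OF pos x(1)] by blast
    then have bS: "b \<notin> S" using Sq a by blast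
    interpret frame_slice S a b c "\<lambda>_. 0" by unfold_locales (use a b bS c in auto)
    have cb: "wedge (snd x $ c) (snd x $ b) \<noteq> 0"
      using b wedge_eq_0_trans[OF Sq[OF a(1) c(1)] _ q0] by blast
    have "row_col (fst x $ c) (snd x $ b) = w c * wedge (snd x $ c) (snd x $ b)"
      by (subst w) (simp add: row_col_perp)
    moreover have "w c \<noteq> 0" using c(2) by (subst (asm) w) auto
    ultimately have "x \<in> nondegenerate" using b cb c(1) by (simp add: nondegenerate_def)
    then show ?thesis using a bS c(1) by (intro exI[of _ a] exI[of _ b] exI[of _ c]) auto
  next
    case False
    then have p0: "fst x $ i = 0" for i using x(2) by (cases "i \<in> S") (auto simp: in_core_def)
    obtain a where a: "a \<in> S" using S by fastforce
    obtain b where b: "wedge (snd x $ a) (snd x $ b) \<noteq> 0" using exists_transverse[OF pos x(1)] by blast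
    then have bS: "b \<notin> S" using Sq a by blast
    define T where "T = {i. wedge (snd x $ a) (snd x $ i) = 0}"
    have "\<exists>c. c \<notin> T \<and> wedge (snd x $ c) (snd x $ b) \<noteq> 0"
    proof (rule ccontr)
      assume "\<not> ?thesis"
      then have *: "wedge (snd x $ c) (snd x $ b) = 0" "wedge (snd x $ b) (snd x $ c) = 0"
        if "c \<notin> T" for c using that wedge_swap[of "snd x $ b"] by auto
      have "wedge (snd x $ i) (snd x $ a) = 0" "wedge (snd x $ a) (snd x $ i) = 0" if "i \<in> T" for i
        using that wedge_swap[of "snd x $ i"] by (auto simp: T_def)
      then have "short \<alpha> T"
        using wedge_eq_0_trans[OF _ _ q0] p0 by (intro level_set_short[OF x(1)]) blast+
      moreover have "short \<alpha> (- T)"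
        using wedge_eq_0_trans[OF * q0] p0 by (intro level_set_short[OF x(1)]) auto
      ultimately show False using short_not_Compl by blast
    qed
    then obtain c where c: "wedge (snd x $ a) (snd x $ c) \<noteq> 0" "wedge (snd x $ c) (snd x $ b) \<noteq> 0"
      by (auto simp: T_def)
    then have cS: "c \<notin> S" "a \<noteq> c" "b \<noteq> c" using Sq a by auto
    interpret frame_slice S a b c "\<lambda>_. 0" by unfold_locales (use a bS cS in auto)
    have "x \<in> nondegenerate" using b c cS by (simp add: nondegenerate_def)
    then show ?thesis using a bS cS by (intro exI[of _ a] exI[of _ b] exI[of _ c]) auto
  qed
  then obtain a b c where abc: "a \<in> S" "b \<notin> S" "a \<noteq> c" "b \<noteq> c"
    and nd: "x \<in> frame_slice.nondegenerate S a b c" by blast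
  \<comment> \<open>If \<open>q\<^sub>i\<close> is parallel to \<open>q\<^sub>b\<close> then it is not parallel to \<open>q\<^sub>a\<close>, so one of the two affine charts
    contains it.\<close>
  define m :: "'n \<Rightarrow> complex" where "m = (\<lambda>i. if wedge (snd x $ i) (snd x $ b) = 0 then 1 else 0)"
  interpret frame_slice S a b c m by unfold_locales (use abc in auto)
  have ab: "wedge (snd x $ a) (snd x $ b) \<noteq> 0" using nd by (simp add: nondegenerate_def)
  have "affine_scale x i \<noteq> 0" for i
  proof (cases "wedge (snd x $ i) (snd x $ b) = 0")
    case True
    then have "wedge (snd x $ a) (snd x $ i) \<noteq> 0"
      using ab wedge_eq_0_trans[OF _ _ q0] by blast
    moreover have "m i = 1" using True by (simp add: m_def)
    ultimately show ?thesis using True nondegenerate_scale[OF nd] by (simp add: affine_scale_def)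
  next
    case False
    then have "m i = 0" by (simp add: m_def)
    then show ?thesis using False by (simp add: affine_scale_def)
  qed
  then have "x \<in> chart_domain" using nd by (simp add: chart_domain_def)
  then show ?thesis
    using exists_adapted_chart[OF _ x(1), of "core_set \<alpha> S"] orbit_in_core_set_iff by blast
qed

section \<open>Limits of the torus action\<close>

lemma p_scale_sel [simp]: "fst (p_scale c x) $ i = c *s fst x $ i" "snd (p_scale c x) = snd x"
  by (cases x; simp add: p_scale_def)+

lemma eq_0_if_bounded_multiples:
  fixes k d :: real
  assumes "k \<ge> 0" "\<And>t. t \<ge> R \<Longrightarrow> t * k < d"
  shows "k = 0"
proof (rule ccontr)
  assume "k \<noteq> 0"
  then have "d \<le> max R (d / k) * k" using assms(1) by (simp add: pos_divide_le_eq[symmetric])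
  then show False using assms(2)[of "max R (d / k)"] by simp
qed

text \<open>
  Two invariant inequalities hold at the limit point and define a saturated open neighbourhood of it.
  Under the torus action the left-hand sides are multiplied by \<open>\<bar>\<lambda>\<bar>\<close> and \<open>\<bar>\<lambda>\<bar>\<^sup>2\<close> while the right-hand
  sides do not change, so they can hold for all large \<open>\<lambda>\<close> only if the left-hand sides are zero.
\<close>

lemma limit_in_fixed_component_imp_core:
  fixes \<alpha> :: "'n::finite \<Rightarrow> real"
  assumes pos: "\<And>i. \<alpha> i > 0" and S: "short \<alpha> S" and z: "z \<in> level_set \<alpha>"
    and y: "y \<in> fixed_component \<alpha> S"
    and lim: "limitin (hyperpolygon_top \<alpha>) (\<lambda>c. cstar c (orbit z)) y at_infinity"
  shows "in_core S z"
proof -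
  obtain p q where y': "y = orbit (p, q)" and x: "(p, q) \<in> level_set \<alpha>"
    and "straight q S" "straight q (- S)" and p0: "\<And>j. j \<notin> S \<Longrightarrow> p $ j = 0"
    using y by (auto simp: fixed_component_def)
  have q0: "q $ i \<noteq> 0" for i using level_set_q[OF x] by simp
  have Sq: "wedge (q $ i) (q $ j) = 0" if "i \<in> S \<and> j \<in> S \<or> i \<notin> S \<and> j \<notin> S" for i j
    using \<open>straight q S\<close> \<open>straight q (- S)\<close> that q0 by (auto simp: straight_iff_wedge)
  have tr: "wedge (q $ i) (q $ j) \<noteq> 0" if ij: "i \<in> S" "j \<notin> S" for i j
  proof
    assume ij0: "wedge (q $ i) (q $ j) = 0"
    then have ij0': "wedge (q $ j) (q $ i) = 0" using wedge_swap[of "q $ j"] by simp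
    have "wedge (q $ i) (q $ k) = 0" for k
      using wedge_eq_0_trans[OF ij0, of "q $ k"] Sq[of j k] Sq[of i k] ij q0 by (cases "k \<in> S") auto
    then show False using exists_transverse[OF pos x, of i] by auto
  qed
  have "\<exists>c\<in>S. p $ c \<noteq> 0"
  proof (rule ccontr)
    assume "\<not> ?thesis"
    then have "p $ i = 0" for i using p0 by (cases "i \<in> S") auto
    then have "short \<alpha> (- S)" using Sq by (intro level_set_short[OF x]) auto
    then show False using short_not_Compl S by blast
  qed
  then obtain c where c: "c \<in> S" "p $ c \<noteq> 0" by blast
  obtain w where w: "(p, q) = conormal_point w q" using level_set_conormal[OF x] by auto
  then have pw: "p $ i = w i *s perp (q $ i)" for i by (simp add: conormal_point_def)
  have wc: "w c \<noteq> 0" using c pw by auto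
  have key: "wedge (snd z $ c) (snd z $ i) = 0 \<and> row_col (fst z $ j) (snd z $ c) = 0 \<and>
      row_col (fst z $ c) (snd z $ j) \<noteq> 0" if ij: "i \<in> S" "j \<notin> S" for i j
  proof -
    define M :: "'n pt set" where "M = {x. row_col (fst x $ c) (snd x $ j) \<noteq> 0 \<and>
      norm (row_col (fst x $ c) (snd x $ j) * wedge (snd x $ c) (snd x $ i))
        < norm (wedge (snd x $ i) (snd x $ j)) \<and>
      norm (row_col (fst x $ j) (snd x $ c) * row_col (fst x $ c) (snd x $ j)) < 1}"
    have "open M" unfolding M_def
      by (intro open_Collect_conj open_Collect_neq open_Collect_less continuous_intros)
    have satM: "x' \<in> M" if "orbit x = orbit x'" "x \<in> M" for x x'
    proof -
      from that(1) obtain e where e: "\<And>i. e i \<noteq> 0"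
        "\<And>i j. wedge (snd x' $ i) (snd x' $ j) = e i * e j * wedge (snd x $ i) (snd x $ j)"
        "\<And>i j. row_col (fst x' $ i) (snd x' $ j) = e j / e i * row_col (fst x $ i) (snd x $ j)"
        by (rule orbit_eqE) blast
      show ?thesis using that(2) e(1)
        by (simp add: M_def e(2,3) norm_mult norm_divide)
    qed
    define T where "T = orbit ` (level_set \<alpha> \<inter> M)"
    have "{x \<in> level_set \<alpha>. orbit x \<in> T} = level_set \<alpha> \<inter> M"
    proof (intro set_eqI iffI)
      fix x assume x: "x \<in> {x \<in> level_set \<alpha>. orbit x \<in> T}"
      then obtain x' where "orbit x' = orbit x" "x' \<in> M" by (auto simp: T_def)
      then show "x \<in> level_set \<alpha> \<inter> M" using satM x by blast
    qed (auto simp: T_def)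
    then have T: "openin (hyperpolygon_top \<alpha>) T"
      using \<open>open M\<close> by (auto simp: openin_hyperpolygon_top T_def hyperpolygon_space_def openin_open)
    have "w j = 0" using p0[OF ij(2)] q0[of j] by (simp add: pw)
    then have "(p, q) \<in> M"
      using tr[OF ij] tr[OF c(1) ij(2)] Sq[of c i] c(1) ij wc
      by (simp add: M_def pw row_col_perp)
    then have "y \<in> T" using x by (auto simp: T_def y')
    then have "eventually (\<lambda>k. cstar k (orbit z) \<in> T) at_infinity"
      using limitinD[OF lim T] by blast
    then obtain R where R: "\<And>k. norm k \<ge> R \<Longrightarrow> cstar k (orbit z) \<in> T"
      unfolding eventually_at_infinity by blast
    have zM: "p_scale k z \<in> M" if k: "norm k \<ge> R" for k
    proof -
      obtain x' where "x' \<in> M" "orbit x' = orbit (p_scale k z)"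
        using R[OF k] by (auto simp: T_def cstar_orbit)
      then show ?thesis using satM by blast
    qed
    \<comment> \<open>The bound \<open>1\<close> makes \<open>t \<le> t\<^sup>2\<close>, which reduces the quadratic estimate to the linear one.\<close>
    define R' where "R' = max R 1"
    have R': "R \<le> t" "1 \<le> t" if "t \<ge> R'" for t using that by (auto simp: R'_def)
    let ?r = "row_col (fst z $ c) (snd z $ j)"
    have "norm (?r * wedge (snd z $ c) (snd z $ i)) = 0"
    proof (rule eq_0_if_bounded_multiples)
      fix t assume "t \<ge> R'"
      then show "t * norm (?r * wedge (snd z $ c) (snd z $ i)) < norm (wedge (snd z $ i) (snd z $ j))"
        using zM[of "of_real t"] R'[of t] by (simp add: M_def norm_mult mult.assoc)
    qed simp
    moreover have "norm (row_col (fst z $ j) (snd z $ c) * ?r) = 0"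
    proof (rule eq_0_if_bounded_multiples)
      fix t assume t: "t \<ge> R'"
      let ?n = "norm (row_col (fst z $ j) (snd z $ c) * ?r)"
      have "t * (t * ?n) < 1"
        using zM[of "of_real t"] R'[OF t] by (simp add: M_def norm_mult mult_ac)
      moreover have "1 * (t * ?n) \<le> t * (t * ?n)" using R'[OF t] by (intro mult_right_mono) auto
      ultimately show "t * ?n < 1" by simp
    qed simp
    moreover have "?r \<noteq> 0" using zM[of "of_real R'"] R'[of R'] by (auto simp: M_def)
    ultimately show ?thesis by simp
  qed
  have zq0: "snd z $ i \<noteq> 0" for i using level_set_q[OF z] .
  obtain v where v: "z = conormal_point v (snd z)" using z by (rule level_set_conormal)
  have pv: "fst z $ i = v i *s perp (snd z $ i)" for i by (subst v) simp
  have "S \<noteq> UNIV" using S not_short_UNIV[of \<alpha>] pos by auto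
  then obtain b where b: "b \<notin> S" by blast
  show ?thesis unfolding in_core_def
  proof (intro conjI ballI)
    fix i j assume ij: "i \<in> S" "j \<in> S"
    have "wedge (snd z $ i) (snd z $ c) = 0" using key[OF ij(1) b] wedge_swap[of "snd z $ i"] by simp
    then show "wedge (snd z $ i) (snd z $ j) = 0"
      using key[OF ij(2) b] wedge_eq_0_trans[OF _ _ zq0] by blast
  next
    fix j assume "j \<in> - S"
    then have "row_col (fst z $ j) (snd z $ c) = 0" "row_col (fst z $ c) (snd z $ j) \<noteq> 0"
      using key[OF c(1)] by auto
    then have "v j * wedge (snd z $ j) (snd z $ c) = 0" "wedge (snd z $ c) (snd z $ j) \<noteq> 0"
      by (auto simp: pv row_col_perp)
    then have "v j = 0" using wedge_swap[of "snd z $ j"] by simp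
    then show "fst z $ j = 0" by (simp add: pv)
  qed
qed

lemma moment_map_conormal_cong:
  assumes "moment_map (conormal_point w q) = 0" "\<And>i. w i \<noteq> 0 \<Longrightarrow> q' $ i = q $ i"
  shows "moment_map (conormal_point w q') = 0"
proof -
  have "(\<Sum>i\<in>UNIV. w i * f (q' $ i)) = (\<Sum>i\<in>UNIV. w i * f (q $ i))" for f :: "complex ^ 2 \<Rightarrow> complex"
  proof (rule sum.cong[OF refl])
    show "w i * f (q' $ i) = w i * f (q $ i)" for i using assms(2)[of i] by (cases "w i = 0") auto
  qed
  from this[of "\<lambda>v. (v $ 1)\<^sup>2"] this[of "\<lambda>v. v $ 1 * v $ 2"] this[of "\<lambda>v. (v $ 2)\<^sup>2"]
  show ?thesis using assms(1) by (simp add: moment_map_conormal_point)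
qed

text \<open>
  The linear map \<open>B\<close> that fixes \<open>q\<^sub>c\<close> and multiplies a transverse vector \<open>u\<close> by \<open>k\<close> has determinant
  \<open>k\<close>. It turns the weights \<open>k w\<close> on \<open>S\<close> back into \<open>w\<close>, while the component along \<open>q\<^sub>c\<close> of each
  vector outside \<open>S\<close>, rescaled by \<open>1 / k\<close>, is multiplied by \<open>1 / k\<close>. With \<open>s = 1 / k\<close> the moving orbit
  is thus represented by a curve \<open>\<gamma> s\<close> in the level set that extends continuously to \<open>s = 0\<close>, where
  the vectors outside \<open>S\<close> are all parallel to \<open>u\<close>.
\<close>

lemma transverse_limit:
  fixes \<alpha> :: "'n::finite \<Rightarrow> real"
  assumes pos: "\<And>i. \<alpha> i > 0" and S: "short \<alpha> S"
    and x: "conormal_point w q \<in> level_set \<alpha>" "in_core S (conormal_point w q)"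
    and c: "c \<in> S" "w c \<noteq> 0" and tr: "\<And>j. j \<notin> S \<Longrightarrow> wedge (q $ c) (q $ j) \<noteq> 0"
  shows "\<exists>y\<in>fixed_component \<alpha> S.
     limitin (hyperpolygon_top \<alpha>) (\<lambda>k. cstar k (orbit (conormal_point w q))) y at_infinity"
proof -
  have q0: "q $ i \<noteq> 0" for i using level_set_q[OF x(1)] by simp
  have Sq: "wedge (q $ i) (q $ j) = 0" if "i \<in> S" "j \<in> S" for i j
    using that x(2) by (auto simp: in_core_def)
  have w0: "w j = 0" if "j \<notin> S" for j using that x(2) q0 by (simp add: in_core_def)
  have "S \<noteq> UNIV" using S not_short_UNIV[of \<alpha>] pos by auto
  then obtain b where b: "b \<notin> S" by blast
  define u where "u = q $ b"
  define \<delta> where "\<delta> = wedge (q $ c) u"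
  have \<delta>: "\<delta> \<noteq> 0" using tr b by (simp add: \<delta>_def u_def)
  define r where "r = (\<lambda>s. \<chi> i. if i \<in> S then q $ i
     else (s * (wedge (q $ i) u / \<delta>)) *s q $ c + (wedge (q $ c) (q $ i) / \<delta>) *s u)"
  define \<gamma> where "\<gamma> = (\<lambda>s. conormal_point w (r s))"
  have rS: "r s $ i = q $ i" if "i \<in> S" for i s using that by (simp add: r_def)
  have rw: "wedge (q $ c) (r s $ j) = wedge (q $ c) (q $ j)" if "j \<notin> S" for s j
    using that \<delta> by (simp add: r_def flip: \<delta>_def)
  have r0: "r s $ i \<noteq> 0" for s i
    using rS[of i s] rw[of i s] tr[of i] q0[of i] by (cases "i \<in> S") (auto simp: wedge_def)
  have level: "\<gamma> s \<in> level_set \<alpha>" for s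
  proof -
    have "moment_map (\<gamma> s) = 0" unfolding \<gamma>_def
      by (rule moment_map_conormal_cong[of w q]) (use x(1) w0 rS in \<open>auto simp: level_set_def\<close>)
    moreover have "stable \<alpha> (\<gamma> s)"
      by (rule stable_of_transverse[OF pos S _ c(1)])
        (use c tr q0 r0 rS rw in \<open>auto simp: \<gamma>_def\<close>)
    ultimately show ?thesis by (simp add: level_set_def)
  qed
  have "continuous_on UNIV (\<lambda>s. r s $ i $ k)" for i k
    using \<delta> by (cases "i \<in> S") (auto simp: r_def intro!: continuous_intros)
  then have "continuous_on UNIV (\<lambda>s. \<chi> i k. r s $ i $ k)" by (intro continuous_on_vec_lambda)
  then have cont: "continuous_on UNIV \<gamma>"
    unfolding \<gamma>_def by (intro continuous_intros) simp
  have orb: "cstar k (orbit (conormal_point w q)) = orbit (\<gamma> (inverse k))" if k: "k \<noteq> 0" for k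
  proof -
    define B :: "(complex ^ 2) ^ 2" where
      "B = (\<chi> i. (1 / \<delta>) *s (q $ c $ i *s vector [u $ 2, - (u $ 1)] + (k * u $ i) *s perp (q $ c)))"
    have Bv: "B *v v = (wedge v u / \<delta>) *s q $ c + (k * wedge (q $ c) v / \<delta>) *s u" for v
      using \<delta> by (simp add: B_def vec2_eq_iff matrix_vector_mult_def sum_2 perp_def wedge_def field_simps)
    have "det B * \<delta> = wedge (B *v q $ c) (B *v u)" by (simp add: wedge_matrix \<delta>_def)
    also have "\<dots> = k * \<delta>" using \<delta> by (simp add: Bv flip: \<delta>_def)
    finally have detB: "det B = k" using \<delta> by simp
    have BS: "B *v q $ i = q $ i" if "i \<in> S" for i
    proof -
      have "\<delta> *s q $ i = wedge (q $ i) u *s q $ c"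
        using wedge_frame[of "q $ c" u "q $ i"] Sq[OF c(1) that] by (simp add: \<delta>_def)
      then have "(1 / \<delta>) *s (\<delta> *s q $ i) = (1 / \<delta>) *s (wedge (q $ i) u *s q $ c)" by simp
      then show ?thesis using \<delta> Sq[OF c(1) that] by (simp add: Bv)
    qed
    have "orbit (conormal_point w (r (inverse k))) = orbit (conormal_point (\<lambda>i. k * w i) q)"
    proof (rule orbit_conormal_point[where B = B and e = "\<lambda>i. if i \<in> S then 1 else inverse k"])
      show "r (inverse k) $ i = (if i \<in> S then 1 else inverse k) *s (B *v q $ i)" for i
      proof (cases "i \<in> S")
        case True
        then show ?thesis by (simp add: r_def BS)
      next
        case False
        then show ?thesis using k \<delta> by (simp add: r_def Bv vec2_eq_iff field_simps)
      qed
      show "k * w i = w i * (if i \<in> S then 1 else inverse k)\<^sup>2 * det B" for i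
        using w0[of i] by (simp add: detB)
    qed (use k detB in auto)
    moreover have "p_scale k (conormal_point w q) = conormal_point (\<lambda>i. k * w i) q"
      by (simp add: p_scale_def conormal_point_def vec_eq_iff)
    ultimately show ?thesis by (simp add: cstar_orbit \<gamma>_def)
  qed
  have "orbit (\<gamma> 0) \<in> fixed_component \<alpha> S"
  proof -
    have "straight (r 0) S" using q0 Sq by (simp add: straight_iff_wedge rS)
    moreover have "straight (r 0) (- S)"
      using r0 by (simp add: straight_iff_wedge) (simp add: r_def)
    moreover have "fst (\<gamma> 0) $ j = 0" if "j \<notin> S" for j using w0[OF that] by (simp add: \<gamma>_def)
    moreover have pair: "(fst (\<gamma> 0), r 0) = \<gamma> 0" by (simp add: \<gamma>_def conormal_point_def)
    ultimately show ?thesis unfolding fixed_component_def mem_Collect_eq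
      by (intro exI[of _ "fst (\<gamma> 0)"] exI[of _ "r 0"]) (unfold pair, simp add: level)
  qed
  moreover have "limitin (hyperpolygon_top \<alpha>) (\<lambda>k. cstar k (orbit (conormal_point w q)))
      (orbit (\<gamma> 0)) at_infinity"
    unfolding limitin_def
  proof (intro conjI allI impI; (elim conjE)?)
    show "orbit (\<gamma> 0) \<in> topspace (hyperpolygon_top \<alpha>)"
      using level by (simp add: topspace_hyperpolygon_top hyperpolygon_space_def)
    fix T assume T: "openin (hyperpolygon_top \<alpha>) T" "orbit (\<gamma> 0) \<in> T"
    have "open {s. orbit (\<gamma> s) \<in> T}" using open_path_preimage[OF cont level T(1)] .
    then have "eventually (\<lambda>k. inverse k \<in> {s. orbit (\<gamma> s) \<in> T}) at_infinity"
      using topological_tendstoD[OF tendsto_inverse_0] T(2) by fastforce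
    moreover have "eventually (\<lambda>k::complex. k \<noteq> 0) at_infinity"
      unfolding eventually_at_infinity by (rule exI[of _ 1]) auto
    ultimately show "eventually (\<lambda>k. cstar k (orbit (conormal_point w q)) \<in> T) at_infinity"
      by eventually_elim (simp add: orb)
  qed
  ultimately show ?thesis by blast
qed

text \<open>
  If \<open>p\<close> vanishes, opposite multiples of the same rank one matrix at two indices of \<open>S\<close> give a
  nonzero solution of the moment equations; this is where \<open>|S| \<ge> 2\<close> enters.
\<close>

lemma exists_transverse_deformation:
  fixes \<alpha> :: "'n::finite \<Rightarrow> real"
  assumes S: "card S \<ge> 2" and x: "conormal_point w q \<in> level_set \<alpha>" "in_core S (conormal_point w q)"
  obtains h c where "c \<in> S" "\<And>t. t \<noteq> 0 \<Longrightarrow> w c + t * h c \<noteq> 0" "\<And>i. i \<notin> S \<Longrightarrow> h i = 0"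
    "moment_map (conormal_point h q) = 0"
proof (cases "\<exists>c\<in>S. w c \<noteq> 0")
  case True
  then obtain c where "c \<in> S" "w c \<noteq> 0" by blast
  then show thesis by (intro that[of c "\<lambda>_. 0"]) (auto simp: moment_map_conormal_point)
next
  case False
  have q0: "q $ i \<noteq> 0" for i using level_set_q[OF x(1)] by simp
  obtain a where a: "a \<in> S" using S by fastforce
  have "\<not> S \<subseteq> {a}" using S card_mono[of "{a}" S] by auto
  then obtain d where d: "d \<in> S" "d \<noteq> a" by auto
  have "wedge (q $ a) (q $ d) = 0" using x(2) a d by (auto simp: in_core_def)
  then obtain k where k: "q $ d = k *s q $ a" using wedge_eq_0_imp_proportional q0 by blast
  then have k0: "k \<noteq> 0" using q0[of d] by auto
  \<comment> \<open>The factor \<open>k\<^sup>2\<close> compensates for \<open>q\<^sub>d q\<^sub>d\<^sup>T = k\<^sup>2 q\<^sub>a q\<^sub>a\<^sup>T\<close>.\<close>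
  define h where "h = (\<lambda>i. if i = a then 1 else if i = d then - 1 / k\<^sup>2 else 0)"
  have sum: "(\<Sum>i\<in>UNIV. h i * f i) = h a * f a + h d * f d" for f
  proof -
    have "(\<Sum>i\<in>UNIV. h i * f i) = (\<Sum>i\<in>{a, d}. h i * f i)"
      by (rule sum.mono_neutral_right) (auto simp: h_def)
    then show ?thesis using d by simp
  qed
  have "moment_map (conormal_point h q) = 0"
    unfolding moment_map_conormal_point sum using d k0
    by (simp add: h_def k power2_eq_square)
  then show thesis using a d False by (intro that[of a h]) (auto simp: h_def)
qed

text \<open>
  Starting at any point of \<open>Y\<close>, the path \<open>\<gamma>\<close> adds multiples of the solution \<open>h\<close> to the weights and
  moves those vectors outside \<open>S\<close> that are parallel to \<open>q\<^sub>c\<close> in the direction of a transverse vector.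
  For \<open>t \<noteq> 0\<close> its points are transverse, hence stable with a limit in the fixed component.
\<close>

lemma core_set_subset_closure:
  fixes \<alpha> :: "'n::finite \<Rightarrow> real"
  assumes pos: "\<And>i. \<alpha> i > 0" and S: "short \<alpha> S" "card S \<ge> 2"
  shows "core_set \<alpha> S \<subseteq> core_component \<alpha> S"
proof
  fix Y assume "Y \<in> core_set \<alpha> S"
  then obtain x where Y: "Y = orbit x" and x: "x \<in> level_set \<alpha>" "in_core S x"
    by (auto simp: core_set_def)
  define q where "q = snd x"
  obtain w where w: "x = conormal_point w q" using level_set_conormal[OF x(1)] by (auto simp: q_def)
  have q0: "q $ i \<noteq> 0" for i using level_set_q[OF x(1)] by (simp add: q_def)
  have Sq: "wedge (q $ i) (q $ j) = 0" if "i \<in> S" "j \<in> S" for i j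
    using that x(2) by (auto simp: in_core_def q_def)
  have w0: "w j = 0" if "j \<notin> S" for j using that x(2) q0 by (simp add: in_core_def w)
  obtain h c where c: "c \<in> S" "\<And>t. t \<noteq> 0 \<Longrightarrow> w c + t * h c \<noteq> 0" and h0: "\<And>i. i \<notin> S \<Longrightarrow> h i = 0"
    and h: "moment_map (conormal_point h q) = 0"
    using exists_transverse_deformation[OF S(2)] x unfolding w by metis
  obtain b where "wedge (snd x $ c) (snd x $ b) \<noteq> 0" using exists_transverse[OF pos x(1)] by blast
  then have b: "wedge (q $ c) (q $ b) \<noteq> 0" by (simp add: q_def)
  define r where "r = (\<lambda>t. \<chi> i. if i \<notin> S \<and> wedge (q $ c) (q $ i) = 0 then q $ i + t *s q $ b else q $ i)"
  define v where "v = (\<lambda>t i. w i + t * h i)"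
  define \<gamma> where "\<gamma> = (\<lambda>t. conormal_point (v t) (r t))"
  have rS: "r t $ i = q $ i" if "i \<in> S" for i t using that by (simp add: r_def)
  have rtr: "wedge (q $ c) (r t $ j) \<noteq> 0" if "j \<notin> S" "t \<noteq> 0" for j t
    using that b by (simp add: r_def)
  have vc: "v t c \<noteq> 0" if "t \<noteq> 0" for t using c(2)[OF that] by (simp add: v_def)
  have r0: "r t $ i \<noteq> 0" if "t \<noteq> 0" for t i
    using rS[of i t] rtr[of i t] q0[of i] that by (cases "i \<in> S") (auto simp: wedge_def)
  have v0: "v t i = 0" if "i \<notin> S" for t i using that w0 h0 by (simp add: v_def)
  have \<gamma>0: "\<gamma> 0 = x"
    by (simp add: \<gamma>_def w v_def r_def if_distrib cong: if_cong)
  have level: "\<gamma> t \<in> level_set \<alpha>" for t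
  proof (cases "t = 0")
    case False
    have "moment_map (conormal_point w q) = 0" using x(1) by (simp add: level_set_def w)
    then have "moment_map (conormal_point (v t) q) = 0"
      using h by (simp add: moment_map_conormal_point v_def distrib_right sum.distrib mult.assoc
          flip: sum_distrib_left)
    then have "moment_map (\<gamma> t) = 0" unfolding \<gamma>_def
      by (rule moment_map_conormal_cong) (use v0 rS in blast)
    moreover have "stable \<alpha> (\<gamma> t)"
      by (rule stable_of_transverse[OF pos S(1) _ c(1)])
        (use c False q0 r0 rS rtr vc in \<open>auto simp: \<gamma>_def\<close>)
    ultimately show ?thesis by (simp add: level_set_def)
  qed (simp add: \<gamma>0 x)
  have core: "in_core S (\<gamma> t)" for t
    using Sq rS v0 by (simp add: in_core_def \<gamma>_def)
  have "continuous_on UNIV (\<lambda>t. r t $ i $ k)" for i k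
    by (cases "i \<notin> S \<and> wedge (q $ c) (q $ i) = 0") (auto simp: r_def intro!: continuous_intros)
  then have "continuous_on UNIV (\<lambda>t. \<chi> i k. r t $ i $ k)" by (intro continuous_on_vec_lambda)
  then have cont: "continuous_on UNIV \<gamma>"
    unfolding \<gamma>_def v_def by (intro continuous_intros) simp
  show "Y \<in> core_component \<alpha> S"
    unfolding core_component_def in_closure_of
  proof (intro conjI allI impI; (elim conjE)?)
    show "Y \<in> topspace (hyperpolygon_top \<alpha>)"
      using x by (simp add: Y topspace_hyperpolygon_top hyperpolygon_space_def)
    fix T assume T: "Y \<in> T" "openin (hyperpolygon_top \<alpha>) T"
    have "open {t. orbit (\<gamma> t) \<in> T}" using open_path_preimage[OF cont level T(2)] .
    moreover have "0 \<in> {t. orbit (\<gamma> t) \<in> T}" using T(1) by (simp add: \<gamma>0 Y)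
    ultimately obtain e where e: "e > 0" "\<And>t. dist t 0 < e \<Longrightarrow> orbit (\<gamma> t) \<in> T"
      unfolding open_dist by blast
    define t where "t = complex_of_real (e / 2)"
    have t: "t \<noteq> 0" "orbit (\<gamma> t) \<in> T" using e(1) by (auto simp: t_def intro!: e(2))
    have "\<exists>y\<in>fixed_component \<alpha> S.
        limitin (hyperpolygon_top \<alpha>) (\<lambda>k. cstar k (orbit (\<gamma> t))) y at_infinity"
      unfolding \<gamma>_def
      by (rule transverse_limit[OF pos S(1) _ _ c(1)])
        (use level[of t, unfolded \<gamma>_def] core[of t, unfolded \<gamma>_def] t rtr vc rS[OF c(1)] in auto)
    then show "\<exists>y. y \<in> {x \<in> hyperpolygon_space \<alpha>. \<exists>y\<in>fixed_component \<alpha> S.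
        limitin (hyperpolygon_top \<alpha>) (\<lambda>c. cstar c x) y at_infinity} \<and> y \<in> T"
      using t(2) level by (auto simp: hyperpolygon_space_def)
  qed
qed

lemma core_component_eq:
  fixes \<alpha> :: "'n::finite \<Rightarrow> real"
  assumes pos: "\<And>i. \<alpha> i > 0" and S: "short \<alpha> S" "card S \<ge> 2"
  shows "core_component \<alpha> S = core_set \<alpha> S"
proof
  show "core_component \<alpha> S \<subseteq> core_set \<alpha> S"
    unfolding core_component_def
  proof (rule closure_of_minimal[OF _ closedin_core_set])
    show "{x \<in> hyperpolygon_space \<alpha>. \<exists>y\<in>fixed_component \<alpha> S.
        limitin (hyperpolygon_top \<alpha>) (\<lambda>c. cstar c x) y at_infinity} \<subseteq> core_set \<alpha> S"
      using limit_in_fixed_component_imp_core[OF pos S(1)]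
      by (auto simp: hyperpolygon_space_def core_set_def)
  qed
qed (rule core_set_subset_closure[OF assms])

text \<open>
  Two different lines, one for \<open>S\<close> and one for its complement, with opposite weights at two indices
  of \<open>S\<close>.
\<close>

lemma core_set_nonempty:
  fixes \<alpha> :: "'n::finite \<Rightarrow> real"
  assumes pos: "\<And>i. \<alpha> i > 0" and S: "short \<alpha> S" "card S \<ge> 2"
  shows "core_set \<alpha> S \<noteq> {}"
proof -
  obtain a where a: "a \<in> S" using S by fastforce
  have "\<not> S \<subseteq> {a}" using S card_mono[of "{a}" S] by auto
  then obtain d where d: "d \<in> S" "d \<noteq> a" by auto
  define h :: "'n \<Rightarrow> complex" where "h = (\<lambda>i. if i = a then 1 else if i = d then - 1 else 0)"
  define q :: "(complex ^ 2) ^ 'n" where "q = (\<chi> i. if i \<in> S then vector [1, 0] else vector [0, 1])"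
  have sum: "(\<Sum>i\<in>UNIV. h i * f i) = f a - f d" for f
  proof -
    have "(\<Sum>i\<in>UNIV. h i * f i) = (\<Sum>i\<in>{a, d}. h i * f i)"
      by (rule sum.mono_neutral_right) (auto simp: h_def)
    then show ?thesis using d by (simp add: h_def)
  qed
  have qw: "wedge (q $ i) (q $ j) = (if i \<in> S \<longleftrightarrow> j \<in> S then 0 else if i \<in> S then 1 else - 1)" for i j
    by (simp add: q_def wedge_def)
  have q0: "q $ i \<noteq> 0" for i by (simp add: q_def vec2_eq_iff)
  have "moment_map (conormal_point h q) = 0"
    unfolding moment_map_conormal_point sum using a d by (simp add: q_def)
  moreover have "stable \<alpha> (conormal_point h q)"
    by (rule stable_of_transverse[OF pos S(1) _ a]) (use q0 qw a in \<open>auto simp: h_def\<close>)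
  moreover have "in_core S (conormal_point h q)"
    using a d by (auto simp: in_core_def qw h_def)
  ultimately show ?thesis unfolding core_set_def level_set_def by blast
qed

theorem theorem2p2:
  fixes \<alpha> :: "'n::finite \<Rightarrow> real" and S :: "'n set"
  assumes "CARD('n) \<ge> 3"
    and "\<And>i. \<alpha> i > 0"
    and "generic \<alpha>"
    and "short \<alpha> S"
    and "card S \<ge> 2"
  shows "smooth_of_dim \<alpha> (CARD('n) - 3) (core_component \<alpha> S) \<and>
    core_component \<alpha> S =
      {orbit (p, q) | p q. (p, q) \<in> level_set \<alpha> \<and> straight q S \<and> (\<forall>j\<in>- S. p $ j = 0)}"
proof
  have eq: "core_component \<alpha> S = core_set \<alpha> S" using assms(2,4,5) by (rule core_component_eq)
  show "smooth_of_dim \<alpha> (CARD('n) - 3) (core_component \<alpha> S)"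
    unfolding eq smooth_of_dim_def
  proof (intro conjI ballI)
    show "core_set \<alpha> S \<noteq> {}" using assms(2,4,5) by (rule core_set_nonempty)
    show "core_set \<alpha> S \<subseteq> hyperpolygon_space \<alpha>" by (auto simp: core_set_def hyperpolygon_space_def)
    fix Y assume "Y \<in> core_set \<alpha> S"
    then obtain x where "Y = orbit x" "x \<in> level_set \<alpha>" "in_core S x" by (auto simp: core_set_def)
    then show "\<exists>W E \<phi> F. Y \<in> W \<and> holomorphic_chart \<alpha> W E \<phi> \<and> F \<subseteq> E \<and> vec.subspace F \<and>
        vec.dim F = CARD('n) - 3 \<and> \<phi> ` (W \<inter> core_set \<alpha> S) = \<phi> ` W \<inter> F"
      using exists_smooth_chart[of \<alpha> S x] assms(2,5) by blast
  qed
  show "core_component \<alpha> S =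
      {orbit (p, q) | p q. (p, q) \<in> level_set \<alpha> \<and> straight q S \<and> (\<forall>j\<in>- S. p $ j = 0)}"
    unfolding eq core_set_alt ..
qed

end
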